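(* Let $p\geq3$ and $\lambda=\lambda_p=2\cos(\pi/p)$. The finite orbits of $\Phi_p$ are exactly the set $\{0\}$ and the sets $$\mathcal{Z}_{\mathcal{A}}=\{\alpha_Q \mid Q\in\mathcal{A},\ Q \text{ is } G_p\text{-simple}\},$$ where $\mathcal{A}$ runs over all $G_p$-equivalence classes of $\lambda$-BQFs consisting of hyperbolic forms.
   Context: Let $S=\begin{pmatrix}1&\lambda\\0&1\end{pmatrix}$, $T=\begin{pmatrix}0&-1\\1&0\end{pmatrix}$, $U=ST$, $G_p=\langle S,T\rangle/\{\pm I\}$ acting on $\mathbb{R}\cup\{\infty\}$ by linear fractional transformations. One has $0=U^p(0)<U^{p-1}(0)<\dots<U^2(0)=\lambda<U(0)=\infty$. Define $\Phi_p:[0,\infty)\to[0,\infty)$ by $\Phi_p(x)=TU^{i}(x)$ where $i\in\{1,\dots,p-1\}$ is the unique index with $U^{p-i+1}(0)\le x<U^{p-i}(0)$ (e.g. $\Phi_p(x)=x/(1-\lambda x)$ on $[0,1/\lambda)$ and $\Phi_p(x)=x-\lambda$ on $[\lambda,\infty)$). A finite orbit of $\Phi_p$ means a finite set on which $\Phi_p$ acts as a single cycle, i.e. $\{x,\Phi_p(x),\dots,\Phi_p^{n-1}(x)\}$ with $\Phi_p^n(x)=x$, $n\ge1$. A $\lambda$-BQF is $Q=[A,B,C]$ ($A,B,C\in\mathbb{Z}[\lambda]$, $D=B^2-4AC>0$), with $\alpha_Q=\frac{-B+\sqrt D}{2A}$; $(Q\circ M)(x,y)=Q(ax+by,cx+dy)$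 for $M=\begin{pmatrix}a&b\\c&d\end{pmatrix}\in G_p$, and $Q\sim Q'$ if $Q'=Q\circ V$ for some $V\in G_p$. Hyperbolic forms are those of the form $Q_\alpha=[c,d-a,-b]$, where $\alpha$ is a real number fixed by an element of $G_p$ with $|{\rm trace}|>2$ and $\begin{pmatrix}a&b\\c&d\end{pmatrix}$ is a generator of its stabilizer chosen up to inversion so that $\alpha=\frac{a-d+\sqrt{(a+d)^2-4}}{2c}$. Each equivalence class contains either only hyperbolic forms or none. A hyperbolic form $[A,B,C]$ is $G_p$-simple if $A>0>C$. *)

theory Defs
  imports Complex_Main
begin

text \<open>2x2 real matrices as tuples (a,b,c,d) standing for [[a,b],[c,d]].\<close>
type_synonym mat2 = "real \<times> real \<times> real \<times> real"

fun mmul :: "mat2 \<Rightarrow> mat2 \<Rightarrow> mat2" where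
  "mmul (a,b,c,d) (e,f,g,h) = (a*e+b*g, a*f+b*h, c*e+d*g, c*f+d*h)"

definition mid :: mat2 where "mid = (1,0,0,1)"

fun mneg :: "mat2 \<Rightarrow> mat2" where
  "mneg (a,b,c,d) = (-a,-b,-c,-d)"

text \<open>Inverse of a determinant-one matrix.\<close>
fun minv :: "mat2 \<Rightarrow> mat2" where
  "minv (a,b,c,d) = (d,-b,-c,a)"

fun mtrace :: "mat2 \<Rightarrow> real" where
  "mtrace (a,b,c,d) = a + d"

definition Smat :: "real \<Rightarrow> mat2" where "Smat l = (1,l,0,1)"
definition Tmat :: mat2 where "Tmat = (0,-1,1,0)"
definition Umat :: "real \<Rightarrow> mat2" where "Umat l = mmul (Smat l) Tmat"

text \<open>The group generated by S and T (as a set of matrices; the quotient by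
  plus/minus I is handled by treating M and -M alike where relevant).\<close>
inductive_set Gp :: "real \<Rightarrow> mat2 set" for l :: real where
  Gp_id: "mid \<in> Gp l"
| Gp_S: "M \<in> Gp l \<Longrightarrow> mmul (Smat l) M \<in> Gp l"
| Gp_Sinv: "M \<in> Gp l \<Longrightarrow> mmul (minv (Smat l)) M \<in> Gp l"
| Gp_T: "M \<in> Gp l \<Longrightarrow> mmul Tmat M \<in> Gp l"
| Gp_Tinv: "M \<in> Gp l \<Longrightarrow> mmul (minv Tmat) M \<in> Gp l"

fun mpow :: "mat2 \<Rightarrow> nat \<Rightarrow> mat2" where
  "mpow M 0 = mid"
| "mpow M (Suc n) = mmul M (mpow M n)"

definition mzpow :: "mat2 \<Rightarrow> int \<Rightarrow> mat2" where
  "mzpow M k = (if k \<ge> 0 then mpow M (nat k) else mpow (minv M) (nat (-k)))"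

fun mob :: "mat2 \<Rightarrow> real \<Rightarrow> real" where
  "mob (a,b,c,d) x = (a*x+b)/(c*x+d)"

fun mfixes :: "mat2 \<Rightarrow> real \<Rightarrow> bool" where
  "mfixes (a,b,c,d) x = (c*x+d \<noteq> 0 \<and> (a*x+b)/(c*x+d) = x)"

text \<open>U^k(0) for k \<ge> 2 (these are finite reals; U(0) = \<infinity>).\<close>
definition Upt :: "real \<Rightarrow> nat \<Rightarrow> real" where
  "Upt l k = mob (mpow (Umat l) k) 0"

text \<open>The map Phi_p on [0,\<infinity>): Phi_p(x) = T U^i (x), where i in {1..p-1} is the
  unique index with U^(p-i+1)(0) \<le> x < U^(p-i)(0); for i = p-1 the upper
  bound is U(0) = \<infinity>.\<close>
definition Phi :: "nat \<Rightarrow> real \<Rightarrow> real \<Rightarrow> real" where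
  "Phi p l x = (let i = (THE i. 1 \<le> i \<and> i \<le> p - 1 \<and> Upt l (p - i + 1) \<le> x
                                  \<and> (p - i = 1 \<or> x < Upt l (p - i)))
                in mob (mmul Tmat (mpow (Umat l) i)) x)"

definition finite_orbit :: "nat \<Rightarrow> real \<Rightarrow> real set \<Rightarrow> bool" where
  "finite_orbit p l Orb \<longleftrightarrow> (\<exists>x n. 0 \<le> x \<and> n \<ge> 1 \<and> (Phi p l ^^ n) x = x
                              \<and> Orb = {(Phi p l ^^ k) x | k. k < n})"

definition Zlam :: "real \<Rightarrow> real set" where
  "Zlam l = {x. \<exists>n (c :: nat \<Rightarrow> int). x = (\<Sum>k<n. of_int (c k) * l ^ k)}"

type_synonym bqf = "real \<times> real \<times> real"

fun disc :: "bqf \<Rightarrow> real" where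
  "disc (A,B,C) = B^2 - 4*A*C"

fun is_lbqf :: "real \<Rightarrow> bqf \<Rightarrow> bool" where
  "is_lbqf l (A,B,C) = (A \<in> Zlam l \<and> B \<in> Zlam l \<and> C \<in> Zlam l \<and> B^2 - 4*A*C > 0)"

fun alphaQ :: "bqf \<Rightarrow> real" where
  "alphaQ (A,B,C) = (-B + sqrt (B^2 - 4*A*C)) / (2*A)"

text \<open>(Q o M)(x,y) = Q(ax+by, cx+dy).\<close>
fun fcomp :: "bqf \<Rightarrow> mat2 \<Rightarrow> bqf" where
  "fcomp (A,B,C) (a,b,c,d) =
     (A*a^2 + B*a*c + C*c^2, 2*A*a*b + B*(a*d+b*c) + 2*C*c*d, A*b^2 + B*b*d + C*d^2)"

definition bqf_equiv :: "real \<Rightarrow> bqf \<Rightarrow> bqf \<Rightarrow> bool" where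
  "bqf_equiv l Q Q' \<longleftrightarrow> (\<exists>V \<in> Gp l. Q' = fcomp Q V)"

text \<open>M generates the stabilizer of alpha in G_p = <S,T>/{+-I}.\<close>
definition stab_generator :: "real \<Rightarrow> mat2 \<Rightarrow> real \<Rightarrow> bool" where
  "stab_generator l M \<alpha> \<longleftrightarrow> M \<in> Gp l \<and> mfixes M \<alpha> \<and>
     (\<forall>N \<in> Gp l. mfixes N \<alpha> \<longrightarrow> (\<exists>k::int. N = mzpow M k \<or> N = mneg (mzpow M k)))"

definition hyperbolic :: "real \<Rightarrow> bqf \<Rightarrow> bool" where
  "hyperbolic l Q \<longleftrightarrow> (\<exists>\<alpha> a b c d.
     (\<exists>N \<in> Gp l. mfixes N \<alpha> \<and> \<bar>mtrace N\<bar> > 2) \<and>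
     stab_generator l (a,b,c,d) \<alpha> \<and>
     \<alpha> = (a - d + sqrt ((a+d)^2 - 4)) / (2*c) \<and>
     Q = (c, d - a, -b))"

fun Gp_simple :: "bqf \<Rightarrow> bool" where
  "Gp_simple (A,B,C) = (A > 0 \<and> 0 > C)"

definition bqf_class :: "real \<Rightarrow> bqf set \<Rightarrow> bool" where
  "bqf_class l \<A> \<longleftrightarrow> (\<exists>Q. is_lbqf l Q \<and> \<A> = {Q'. is_lbqf l Q' \<and> bqf_equiv l Q Q'})"

end

theory Submission
  imports Defs
begin

text \<open>
  Up to sign, \<open>\<Phi>\<close> inverts on the \<open>j\<close>-th interval the nonnegative matrix \<open>H j = \<plusminus> U\<^sup>j T\<close>, so a
  point \<open>x \<ge> 0\<close> is coded by the sequence of its digits \<open>j\<close>. For every \<open>N\<close> in the group, \<open>N\<close> times a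
  long enough initial product of the coding of \<open>x\<close> is, up to sign, a product of matrices \<open>H j\<close> or
  \<open>T\<close> times one. Hence equivalent nonnegative points have merging \<open>\<Phi>\<close>-orbits; the product over a
  minimal period generates the stabilizer of a periodic \<open>x > 0\<close>; and a hyperbolic fixed point is
  eventually periodic. The form attached to a periodic \<open>x > 0\<close> is simple because its matrix has positive
  off-diagonal entries. Conversely \<open>\<Phi>\<close> acts on simple forms invertibly (the conjugate root is negative
  and determines the previous digit), so a simple form equivalent to a periodic one is itself periodic.
\<close>

subsection \<open>Matrices\<close>

text \<open>S is -U T, so U and T generate the group. Left multiplication by either one only touches
  the leading letter of a word: up to sign, U T is \<open>H 1\<close>, U raises \<open>H j\<close>
  to \<open>H (j+1)\<close>, and \<open>H p\<close> is T. The only obstruction is the trivial word,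
  which has no letter to raise; this is what forces the initial product of x to be lengthened. A
  product with T in front would send a nonnegative point to a negative number or to infinity, so
  this alternative drops out once both points are nonnegative. The point 0 stands apart: it is fixed
  by \<Phi>, its letter \<open>H (p-1)\<close> is parabolic, and no simple form has root 0.
  Arguments with forms therefore keep all iterates strictly positive. A stabilizer generator is
  determined up to sign and inversion. Either change negates the form, and the choice of the
  \<open>+ sqrt\<close> root in \<open>alphaQ\<close> removes this ambiguity.\<close>

definition mdet :: "mat2 \<Rightarrow> real" where
  "mdet M = (case M of (a,b,c,d) \<Rightarrow> a*d - b*c)"

lemma mdet_simp [simp]: "mdet (a,b,c,d) = a*d - b*c"
  by (simp add: mdet_def)

lemma mmul_assoc: "mmul (mmul L M) N = mmul L (mmul M N)"
  by (cases L; cases M; cases N) (simp add: algebra_simps)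

lemma mmul_mid [simp]: "mmul mid M = M" "mmul M mid = M"
  by (cases M; simp add: mid_def)+

lemma mmul_mneg [simp]: "mmul (mneg M) N = mneg (mmul M N)" "mmul M (mneg N) = mneg (mmul M N)"
  by (cases M; cases N; simp)+

lemma mneg_mneg [simp]: "mneg (mneg M) = M"
  by (cases M) simp

lemma mdet_mmul [simp]: "mdet (mmul M N) = mdet M * mdet N"
  by (cases M; cases N) (simp add: algebra_simps)

lemma mdet_mid [simp]: "mdet mid = 1"
  by (simp add: mid_def)

lemma mdet_minv [simp]: "mdet (minv M) = mdet M"
  by (cases M) simp

lemma minv_minv [simp]: "minv (minv M) = M"
  by (cases M) simp

lemma minv_mneg: "minv (mneg M) = mneg (minv M)"
  by (cases M) simp

lemma minv_mmul: "minv (mmul M N) = mmul (minv N) (minv M)"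
  by (cases M; cases N) (simp add: algebra_simps)

lemma minv_left [simp]: "mdet M = 1 \<Longrightarrow> mmul (minv M) M = mid"
  by (cases M) (simp add: algebra_simps mid_def)

lemma minv_right [simp]: "mdet M = 1 \<Longrightarrow> mmul M (minv M) = mid"
  by (cases M) (simp add: algebra_simps mid_def)

lemma minv_left_cancel [simp]: "mdet M = 1 \<Longrightarrow> mmul (minv M) (mmul M N) = N"
  by (metis mmul_assoc minv_left mmul_mid(1))

lemma minv_right_cancel [simp]: "mdet M = 1 \<Longrightarrow> mmul M (mmul (minv M) N) = N"
  by (metis mmul_assoc minv_right mmul_mid(1))

lemma mpow_add: "mpow M (m + n) = mmul (mpow M m) (mpow M n)"
  by (induction m) (auto simp: mmul_assoc)

lemma mdet_mpow: "mdet M = 1 \<Longrightarrow> mdet (mpow M n) = 1"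
  by (induction n) auto

lemma minv_mid [simp]: "minv mid = mid"
  by (simp add: mid_def)

lemma mpow_Suc_right: "mpow M (Suc n) = mmul (mpow M n) M"
  using mpow_add[of M n 1] by simp

lemma minv_mpow: "minv (mpow M n) = mpow (minv M) n"
proof (induction n)
  case (Suc n)
  have "minv (mpow M (Suc n)) = mmul (mpow (minv M) n) (minv M)"
    by (simp add: minv_mmul Suc)
  then show ?case by (simp only: mpow_Suc_right)
qed simp

lemma mpow_conj:
  assumes "mdet V = 1"
  shows "mpow (mmul (minv V) (mmul M V)) n = mmul (minv V) (mmul (mpow M n) V)"
  by (induction n) (use assms in \<open>auto simp: mmul_assoc\<close>)

lemma mzpow_conj:
  assumes "mdet V = 1"
  shows "mzpow (mmul (minv V) (mmul M V)) k = mmul (minv V) (mmul (mzpow M k) V)"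
proof -
  have "minv (mmul (minv V) (mmul M V)) = mmul (minv V) (mmul (minv M) V)"
    by (simp add: minv_mmul mmul_assoc)
  then show ?thesis
    by (simp add: mzpow_def mpow_conj assms)
qed

lemma mtrace_conj:
  assumes "mdet V = 1"
  shows "mtrace (mmul (minv V) (mmul M V)) = mtrace M"
proof -
  obtain a b c d e f g h where "V = (a,b,c,d)" "M = (e,f,g,h)" by (metis surj_pair)
  moreover from this have "a*d - b*c = 1" using assms by simp
  then have "d*(e*a + f*c) - b*(g*a + h*c) + (a*(g*b + h*d) - c*(e*b + f*d)) = e + h" by algebra
  ultimately show ?thesis by simp
qed

text \<open>\<open>mu x M\<close> is an eigenvalue of \<open>M\<close> when \<open>M\<close> fixes \<open>x\<close>, so \<open>ln \<bar>mu x M\<bar>\<close> is additive on the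
  stabilizer of \<open>x\<close> and vanishes exactly on its non-hyperbolic elements.\<close>
definition fixpol :: "mat2 \<Rightarrow> real \<Rightarrow> bool" where
  "fixpol M x = (case M of (a,b,c,d) \<Rightarrow> a*x + b = x*(c*x + d))"

lemma fixpol_simp [simp]: "fixpol (a,b,c,d) x \<longleftrightarrow> a*x + b = x*(c*x + d)"
  by (simp add: fixpol_def)

definition mu :: "real \<Rightarrow> mat2 \<Rightarrow> real" where
  "mu x M = (case M of (a,b,c,d) \<Rightarrow> c*x + d)"

lemma mu_simp [simp]: "mu x (a,b,c,d) = c*x + d"
  by (simp add: mu_def)

text \<open>\<open>(x, 1)\<close> is an eigenvector with eigenvalue \<open>c*x + d\<close>; the
  other eigenvalue is \<open>a - c*x\<close>, its inverse because the determinant is 1.\<close>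

lemma fixpol_mu_trace:
  assumes "mdet M = 1" "fixpol M x"
  shows "mu x M \<noteq> 0" "mtrace M = mu x M + 1 / mu x M"
proof -
  obtain a b c d where M: "M = (a,b,c,d)" by (metis surj_pair)
  have e: "a*d - b*c = 1" "a*x + b = x*(c*x + d)" using assms M by auto
  have k: "(a - c*x)*(c*x + d) = 1" using e by algebra
  then show "mu x M \<noteq> 0" using M by auto
  then have "1 / mu x M = a - c*x" using k M by (metis mu_simp nonzero_eq_divide_eq)
  then show "mtrace M = mu x M + 1 / mu x M" using M by simp
qed

text \<open>If \<open>c*x + d\<close> vanished, the fixed-point equation would make
  \<open>a*x + b\<close> vanish too, and \<open>M\<close> would be singular.\<close>

lemma mfixes_iff_fixpol:
  assumes "mdet M = 1" shows "mfixes M x \<longleftrightarrow> fixpol M x"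
proof -
  obtain a b c d where M: "M = (a,b,c,d)" by (metis surj_pair)
  show ?thesis using fixpol_mu_trace(1)[OF assms, of x] M
    by (auto simp: field_simps)
qed

lemma fixpol_mid [simp]: "fixpol mid x" "mu x mid = 1"
  by (auto simp: mid_def)

lemma fixpol_mmul:
  assumes "fixpol M x" "fixpol N x"
  shows "fixpol (mmul M N) x" "mu x (mmul M N) = mu x M * mu x N"
proof -
  obtain a b c d e f g h where MN: "M = (a,b,c,d)" "N = (e,f,g,h)" by (metis surj_pair)
  have e: "a*x + b = x*(c*x + d)" "e*x + f = x*(g*x + h)" using assms MN by auto
  have 2: "(c*e+d*g)*x + (c*f+d*h) = (c*x+d)*(g*x+h)" using e by algebra
  then show "mu x (mmul M N) = mu x M * mu x N" using MN by simp
  have "(a*e+b*g)*x + (a*f+b*h) = x*((c*x+d)*(g*x+h))" using e by algebra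
  then show "fixpol (mmul M N) x" using MN 2 by simp
qed

lemma fixpol_mneg [simp]: "fixpol (mneg M) x \<longleftrightarrow> fixpol M x" "mu x (mneg M) = - mu x M"
proof -
  obtain a b c d where M: "M = (a,b,c,d)" by (metis surj_pair)
  show "fixpol (mneg M) x \<longleftrightarrow> fixpol M x" "mu x (mneg M) = - mu x M"
    unfolding M by (auto simp: algebra_simps)
qed

lemma fixpol_minv:
  assumes "mdet M = 1" "fixpol M x"
  shows "fixpol (minv M) x" "mu x (minv M) = 1 / mu x M"
proof -
  obtain a b c d where M: "M = (a,b,c,d)" by (metis surj_pair)
  have e: "a*d - b*c = 1" "a*x + b = x*(c*x + d)" using assms M by auto
  have "d*x - b = x*(-c*x + a)" using e by algebra
  then show "fixpol (minv M) x" using M by simp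
  have k: "(a - c*x)*(c*x + d) = 1" using e by algebra
  then have "a - c*x = 1 / (c*x + d)" by (metis mult_zero_right nonzero_eq_divide_eq zero_neq_one)
  then show "mu x (minv M) = 1 / mu x M" using M by simp
qed

lemma fixpol_mpow:
  assumes "fixpol M x"
  shows "fixpol (mpow M n) x" "mu x (mpow M n) = mu x M ^ n"
proof -
  have "fixpol (mpow M n) x \<and> mu x (mpow M n) = mu x M ^ n"
    by (induction n) (auto simp: fixpol_mmul assms)
  then show "fixpol (mpow M n) x" "mu x (mpow M n) = mu x M ^ n" by auto
qed

lemma ln_mu_mzpow:
  assumes "mdet M = 1" "fixpol M x"
  shows "ln \<bar>mu x (mzpow M k)\<bar> = of_int k * ln \<bar>mu x M\<bar>"
proof (cases "k \<ge> 0")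
  case True
  then show ?thesis
    using fixpol_mpow[OF assms(2)] fixpol_mu_trace(1)[OF assms]
    by (simp add: mzpow_def power_abs ln_realpow of_nat_nat)
next
  case False
  then show ?thesis
    using fixpol_mpow[OF fixpol_minv(1)[OF assms]] fixpol_minv(2)[OF assms] fixpol_mu_trace(1)[OF assms]
    by (simp add: mzpow_def power_abs ln_realpow of_nat_nat ln_div)
qed

text \<open>With \<open>m\<close> the eigenvalue, \<open>|m| + 1/|m|\<close> exceeds 2 by
  \<open>(|m| - 1)^2 / |m|\<close>, which vanishes only for \<open>|m| = 1\<close>.\<close>

lemma abs_trace_gt_2_iff:
  assumes "mdet M = 1" "fixpol M x"
  shows "\<bar>mtrace M\<bar> > 2 \<longleftrightarrow> ln \<bar>mu x M\<bar> \<noteq> 0"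
proof -
  define m where "m = mu x M"
  have m: "m \<noteq> 0" "mtrace M = m + 1/m" using fixpol_mu_trace[OF assms] m_def by auto
  have "\<bar>mtrace M\<bar> = \<bar>m\<bar> + 1/\<bar>m\<bar>"
  proof (cases "m > 0")
    case True
    then have "m + 1/m > 0" by (simp add: add_pos_pos)
    then show ?thesis using True m by simp
  next
    case False
    then have "m < 0" "1/m < 0" using m by auto
    then have "m + 1/m < 0" by linarith
    then show ?thesis unfolding m(2) using \<open>m < 0\<close> by simp
  qed
  also have "\<dots> = 2 + (\<bar>m\<bar> - 1)\<^sup>2 / \<bar>m\<bar>"
    using m(1) by (simp add: field_simps power2_eq_square)
  finally have *: "\<bar>mtrace M\<bar> = 2 + (\<bar>m\<bar> - 1)\<^sup>2 / \<bar>m\<bar>" .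
  have "\<bar>mtrace M\<bar> > 2 \<longleftrightarrow> \<bar>m\<bar> \<noteq> 1"
  proof
    assume "\<bar>m\<bar> \<noteq> 1"
    then have "(\<bar>m\<bar> - 1)\<^sup>2 / \<bar>m\<bar> > 0" using m(1) by simp
    then show "\<bar>mtrace M\<bar> > 2" using * by linarith
  qed (use * in auto)
  then show ?thesis using m(1) by (simp add: m_def[symmetric])
qed

subsection \<open>The group\<close>

definition peq :: "mat2 \<Rightarrow> mat2 \<Rightarrow> bool" where
  "peq M N \<longleftrightarrow> M = N \<or> M = mneg N"

lemma peq_refl [simp]: "peq M M"
  by (simp add: peq_def)

lemma peq_sym: "peq M N \<Longrightarrow> peq N M"
  by (auto simp: peq_def)

lemma peq_trans [trans]: "peq L M \<Longrightarrow> peq M N \<Longrightarrow> peq L N"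
  by (auto simp: peq_def)

lemma peq_mmul: "peq L M \<Longrightarrow> peq L' M' \<Longrightarrow> peq (mmul L L') (mmul M M')"
  by (auto simp: peq_def)

lemma peq_mneg [simp]: "peq (mneg M) N \<longleftrightarrow> peq M N" "peq M (mneg N) \<longleftrightarrow> peq M N"
  by (auto simp: peq_def) (metis mneg_mneg)

lemma mdet_T [simp]: "mdet Tmat = 1"
  by (simp add: Tmat_def)

lemma mdet_S [simp]: "mdet (Smat l) = 1"
  by (simp add: Smat_def)

lemma mdet_U [simp]: "mdet (Umat l) = 1"
  by (simp add: Umat_def)

lemma T_square: "mmul Tmat Tmat = mneg mid"
  by (simp add: Tmat_def mid_def)

lemma minv_T: "minv Tmat = mneg Tmat"
  by (simp add: Tmat_def)

lemma mdet_Gp: "M \<in> Gp l \<Longrightarrow> mdet M = 1"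
  by (induction rule: Gp.induct) auto

lemma Gp_mmul: "M \<in> Gp l \<Longrightarrow> N \<in> Gp l \<Longrightarrow> mmul M N \<in> Gp l"
  by (induction rule: Gp.induct) (auto simp: mmul_assoc intro: Gp.intros)

lemma Gp_gens: "Smat l \<in> Gp l" "Tmat \<in> Gp l" "minv (Smat l) \<in> Gp l" "minv Tmat \<in> Gp l"
  using Gp.intros(2-5)[OF Gp.Gp_id] by auto

lemma Gp_minv: "M \<in> Gp l \<Longrightarrow> minv M \<in> Gp l"
  by (induction rule: Gp.induct) (auto simp: minv_mmul Gp_gens intro!: Gp_mmul intro: Gp.intros)

lemma Gp_mneg: "M \<in> Gp l \<Longrightarrow> mneg M \<in> Gp l"
proof -
  assume "M \<in> Gp l"
  then have "mmul (mmul Tmat Tmat) M \<in> Gp l" by (intro Gp_mmul Gp_gens)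
  then show ?thesis by (simp add: T_square)
qed

lemma Gp_U: "Umat l \<in> Gp l"
  unfolding Umat_def by (intro Gp_mmul Gp_gens)

lemma Gp_mpow: "M \<in> Gp l \<Longrightarrow> mpow M n \<in> Gp l"
  by (induction n) (auto intro: Gp.intros Gp_mmul)

lemma Gp_conj: "M \<in> Gp l \<Longrightarrow> V \<in> Gp l \<Longrightarrow> mmul (minv V) (mmul M V) \<in> Gp l"
  by (intro Gp_mmul Gp_minv)

section \<open>Coefficients in Z[\<lambda>]\<close>

lemma Zlam_shift: "x \<in> Zlam l \<Longrightarrow> l * x \<in> Zlam l"
proof -
  assume "x \<in> Zlam l"
  then obtain n c where x: "x = (\<Sum>k<n. of_int (c k) * l ^ k)"
    by (auto simp: Zlam_def)
  define c' where "c' = (\<lambda>k. if k = 0 then 0 else c (k - 1 :: nat) :: int)"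
  have "l * x = (\<Sum>k<n. of_int (c' (Suc k)) * l ^ Suc k)"
    by (simp add: x c'_def sum_distrib_left algebra_simps)
  also have "\<dots> = (\<Sum>k<Suc n. of_int (c' k) * l ^ k)"
    by (simp only: sum.lessThan_Suc_shift) (simp add: c'_def)
  finally show ?thesis unfolding Zlam_def by blast
qed

lemma Zlam_extend:
  assumes "(x::real) = (\<Sum>k<n. of_int (c k) * l ^ k)" "n \<le> m"
  shows "x = (\<Sum>k<m. of_int (if k < n then c k else 0) * l ^ k)"
proof -
  have "(\<Sum>k<m. of_int (if k < n then c k else 0) * l ^ k) =
        (\<Sum>k<n. of_int (if k < n then c k else 0) * l ^ k)"
    by (rule sum.mono_neutral_right) (use assms(2) in auto)
  then show ?thesis using assms(1) by simp
qed

lemma Zlam_add: "x \<in> Zlam l \<Longrightarrow> y \<in> Zlam l \<Longrightarrow> x + y \<in> Zlam l"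
proof -
  assume "x \<in> Zlam l" "y \<in> Zlam l"
  then obtain n c m e where x: "x = (\<Sum>k<n. of_int (c k) * l ^ k)"
    and y: "y = (\<Sum>k<m. of_int (e k) * l ^ k)"
    by (auto simp: Zlam_def)
  have "x + y = (\<Sum>k<max n m. of_int ((if k < n then c k else 0) + (if k < m then e k else 0)) * l ^ k)"
    using Zlam_extend[OF x, of "max n m"] Zlam_extend[OF y, of "max n m"]
    by (simp only: of_int_add distrib_right sum.distrib)
  then show ?thesis
    unfolding Zlam_def
    by (intro CollectI exI[of _ "max n m"]
        exI[of _ "\<lambda>k. (if k < n then c k else 0) + (if k < m then e k else 0)"])
qed

lemma Zlam_minus: "x \<in> Zlam l \<Longrightarrow> - x \<in> Zlam l"
proof -
  assume "x \<in> Zlam l"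
  then obtain n c where x: "x = (\<Sum>k<n. of_int (c k) * l ^ k)"
    by (auto simp: Zlam_def)
  have "- x = (\<Sum>k<n. of_int (- c k) * l ^ k)" by (simp add: x sum_negf)
  then show ?thesis unfolding Zlam_def
    by (intro CollectI exI[of _ n] exI[of _ "\<lambda>k. - c k"])
qed

lemma Zlam_0: "0 \<in> Zlam l"
  unfolding Zlam_def by (intro CollectI exI[of _ 0]) simp

lemma Zlam_1: "1 \<in> Zlam l"
  unfolding Zlam_def by (intro CollectI exI[of _ 1] exI[of _ "\<lambda>_. 1"]) simp

fun entries_in :: "real set \<Rightarrow> mat2 \<Rightarrow> bool" where
  "entries_in X (a,b,c,d) \<longleftrightarrow> a \<in> X \<and> b \<in> X \<and> c \<in> X \<and> d \<in> X"

text \<open>From the left, a generator swaps or negates rows or adds \<open>l\<close> or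
  \<open>-l\<close> times one row to the other, so the closure properties above suffice.\<close>

lemma Gp_entries: "M \<in> Gp l \<Longrightarrow> entries_in (Zlam l) M"
proof (induction rule: Gp.induct)
  case Gp_id
  then show ?case by (simp add: mid_def Zlam_0 Zlam_1)
next
  case (Gp_Sinv M)
  obtain a b c d where M: "M = (a,b,c,d)" by (metis surj_pair)
  have "x - l * y \<in> Zlam l" if "x \<in> Zlam l" "y \<in> Zlam l" for x y
    using Zlam_add[OF that(1) Zlam_minus[OF Zlam_shift[OF that(2)]]] by simp
  then show ?case using Gp_Sinv by (simp add: M Smat_def)
qed (auto simp: Smat_def Tmat_def split_paired_all intro: Zlam_add Zlam_shift Zlam_minus)

subsection \<open>Quadratic forms\<close>

lemma fcomp_mmul: "fcomp (fcomp Q V) W = fcomp Q (mmul V W)"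
  by (cases Q; cases V; cases W) (simp add: algebra_simps power2_eq_square)

lemma fcomp_mneg [simp]: "fcomp Q (mneg V) = fcomp Q V"
  by (cases Q; cases V) simp

lemma fcomp_peq: "peq V W \<Longrightarrow> fcomp Q V = fcomp Q W"
  by (auto simp: peq_def)

lemma fcomp_mid [simp]: "fcomp Q mid = Q"
  by (cases Q) (simp add: mid_def)

lemma disc_fcomp: "mdet V = 1 \<Longrightarrow> disc (fcomp Q V) = disc Q"
proof -
  assume d: "mdet V = 1"
  obtain A B C a b c d where QV: "Q = (A,B,C)" "V = (a,b,c,d)" by (metis surj_pair)
  have "a*d - b*c = 1" using d QV by simp
  then have "(2*A*a*b + B*(a*d+b*c) + 2*C*c*d)\<^sup>2 - 4*(A*a\<^sup>2 + B*a*c + C*c\<^sup>2)*(A*b\<^sup>2 + B*b*d + C*d\<^sup>2) = B\<^sup>2 - 4*A*C"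
    by algebra
  then show ?thesis using QV by simp
qed

lemma fcomp_cancel:
  assumes "mdet V = 1" "fcomp Q V = fcomp Q' V" shows "Q = Q'"
proof -
  have "fcomp (fcomp Q V) (minv V) = fcomp (fcomp Q' V) (minv V)" using assms(2) by simp
  then show ?thesis using assms(1) by (simp add: fcomp_mmul)
qed

definition form :: "mat2 \<Rightarrow> bqf" where
  "form M = (case M of (a,b,c,d) \<Rightarrow> (c, d - a, -b))"

lemma form_simp [simp]: "form (a,b,c,d) = (c, d - a, -b)"
  by (simp add: form_def)

text \<open>\<open>form M\<close> evaluated at a vector \<open>v\<close> is the determinant with
  columns \<open>v\<close> and \<open>M v\<close>. Replacing \<open>v\<close> by \<open>V v\<close>
  and pulling out \<open>V\<close>, of determinant 1, conjugates \<open>M\<close>.\<close>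

lemma form_conj:
  assumes "mdet V = 1"
  shows "fcomp (form M) V = form (mmul (minv V) (mmul M V))"
  by (cases M; cases V) (simp add: algebra_simps power2_eq_square)

lemma disc_form: "mdet M = 1 \<Longrightarrow> disc (form M) = (mtrace M)\<^sup>2 - 4"
proof -
  assume m: "mdet M = 1"
  obtain a b c d where M: "M = (a,b,c,d)" by (metis surj_pair)
  have "a*d - b*c = 1" using m M by simp
  then have "(d - a)\<^sup>2 - 4*c*(-b) = (a+d)\<^sup>2 - 4" by algebra
  then show ?thesis by (simp add: M)
qed

text \<open>Records the choice of root without division: the derivative of the quadratic polynomial
  at the chosen root is plus the square root of the discriminant.\<close>

lemma alphaQ_iff:
  assumes "A \<noteq> 0"
  shows "alphaQ (A,B,C) = x \<longleftrightarrow> 2*A*x + B = sqrt (disc (A,B,C))"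
  using assms by (auto simp: field_simps)

lemma alphaQ_root:
  assumes "A \<noteq> 0" "disc (A,B,C) \<ge> 0" "2*A*x + B = sqrt (disc (A,B,C))"
  shows "A*x\<^sup>2 + B*x + C = 0"
proof -
  have "(2*A*x + B)\<^sup>2 = B\<^sup>2 - 4*A*C" using assms(2,3) by simp
  then have "4*A*(A*x\<^sup>2 + B*x + C) = 0" by algebra
  then show ?thesis using assms(1) by simp
qed

text \<open>Multiplying out \<open>mob M y = x\<close> gives a relation that is also meaningful at the pole of \<open>M\<close>;
  for a nonsingular \<open>M\<close> it fails there.\<close>
definition sends :: "mat2 \<Rightarrow> real \<Rightarrow> real \<Rightarrow> bool" where
  "sends M y x = (case M of (a,b,c,d) \<Rightarrow> a*y + b = x*(c*y + d))"

lemma sends_simp [simp]: "sends (a,b,c,d) y x \<longleftrightarrow> a*y + b = x*(c*y + d)"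
  by (simp add: sends_def)

lemma sends_mneg [simp]: "sends (mneg M) y x \<longleftrightarrow> sends M y x"
proof -
  obtain a b c d where M: "M = (a,b,c,d)" by (metis surj_pair)
  show ?thesis by (auto simp: M algebra_simps)
qed

lemma sends_self: "sends M x x \<longleftrightarrow> fixpol M x"
  by (cases M) simp

lemma sends_mmul:
  assumes "sends N z y" "sends M y x" shows "sends (mmul M N) z x"
proof -
  obtain a b c d e f g h where MN: "M = (a,b,c,d)" "N = (e,f,g,h)" by (metis surj_pair)
  have "e*z + f = y*(g*z + h)" "a*y + b = x*(c*y + d)" using assms MN by auto
  then have "(a*e+b*g)*z + (a*f+b*h) = x*((c*e+d*g)*z + (c*f+d*h))" by algebra
  then show ?thesis using MN by simp
qed

lemma sends_minv:
  assumes "mdet M = 1" "sends M y x" shows "sends (minv M) x y"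
proof -
  obtain a b c d where M: "M = (a,b,c,d)" by (metis surj_pair)
  have "a*d - b*c = 1" "a*y + b = x*(c*y + d)" using assms M by auto
  then have "d*x - b = y*(-c*x + a)" by algebra
  then show ?thesis using M by simp
qed

lemma sends_inj:
  assumes "mdet M = 1" "sends M y x" "sends M z x" shows "y = z"
proof -
  obtain a b c d where M: "M = (a,b,c,d)" by (metis surj_pair)
  have "a*d - b*c = 1" "a*y + b = x*(c*y + d)" "a*z + b = x*(c*z + d)" using assms M by auto
  moreover from this have "(a*y + b)*(c*z + d) = (a*z + b)*(c*y + d)" by algebra
  ultimately have "y - z = 0" by algebra
  then show ?thesis by simp
qed

lemma alphaQ_fcomp:
  assumes "mdet V = 1" "disc Q \<ge> 0" "fst Q \<noteq> 0" "fst (fcomp Q V) \<noteq> 0"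
  shows "sends V (alphaQ (fcomp Q V)) (alphaQ Q)"
proof -
  obtain A B C a b c d where QV: "Q = (A,B,C)" "V = (a,b,c,d)" by (metis surj_pair)
  obtain A' B' C' where Q': "fcomp Q V = (A',B',C')" by (metis surj_pair)
  have e: "A' = A*a\<^sup>2 + B*a*c + C*c\<^sup>2" "B' = 2*A*a*b + B*(a*d+b*c) + 2*C*c*d"
    "C' = A*b\<^sup>2 + B*b*d + C*d\<^sup>2" using Q' QV by auto
  have det: "a*d - b*c = 1" using assms(1) QV by simp
  have D: "disc (A',B',C') = disc (A,B,C)" using disc_fcomp[OF assms(1), of Q] by (simp only: Q'[symmetric] QV(1)[symmetric])
  define y where "y = alphaQ (fcomp Q V)"
  have y: "2*A'*y + B' = sqrt (disc (A',B',C'))"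
    using alphaQ_iff[of A' B' C' y] assms(4) Q' y_def by simp
  have r: "A'*y\<^sup>2 + B'*y + C' = 0"
    using alphaQ_root[OF _ _ y] assms Q' D QV by simp
  have hom: "A*(a*y+b)\<^sup>2 + B*(a*y+b)*(c*y+d) + C*(c*y+d)\<^sup>2 = 0"
    using r unfolding e by algebra
  have A0: "A \<noteq> 0" using assms(3) QV by simp
  \<comment> \<open>At the pole the homogeneous equation would annihilate the numerator as well,
    contradicting determinant 1.\<close>
  have nz: "c*y + d \<noteq> 0"
  proof
    assume z: "c*y + d = 0"
    then have "a*y + b = 0" using hom A0 by simp
    with z det show False by algebra
  qed
  define w where "w = (a*y+b)/(c*y+d)"
  have w: "a*y + b = w*(c*y + d)" using nz by (simp add: w_def)
  have "(c*y+d)\<^sup>2 * (A*w\<^sup>2 + B*w + C) = 0" using hom unfolding w by algebra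
  then have wr: "A*w\<^sup>2 + B*w + C = 0" using nz by simp
  have "(a - c*w)*(c*y + d) = 1" using w det by algebra
  \<comment> \<open>The derivative at a root is invariant: the factor \<open>(c*y+d)^2\<close> from
    homogenizing cancels the derivative of the Moebius map. So the \<open>+ sqrt\<close> root goes
    to the \<open>+ sqrt\<close> root and not to its conjugate.\<close>
  then have "2*A'*y + B' = 2*A*w + B"
    using w wr unfolding e by algebra
  then have "2*A*w + B = sqrt (disc (A,B,C))" using y D by simp
  then have "alphaQ Q = w" using alphaQ_iff[of A B C w] A0 QV by simp
  then show ?thesis using w y_def QV by simp
qed

lemma alphaQ_factor:
  assumes "A > 0" "y > 0" "t > 0"
  shows "alphaQ (A, A*(t-y), - A*y*t) = y"
proof -
  have "disc (A, A*(t-y), - A*y*t) = (A*(t+y))\<^sup>2"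
    by simp algebra
  then have "sqrt (disc (A, A*(t-y), - A*y*t)) = A*(t+y)"
    using assms by simp
  then show ?thesis using alphaQ_iff[of A "A*(t-y)" "- A*y*t" y] assms by (simp add: algebra_simps)
qed

text \<open>Simplicity means roots of opposite signs, \<open>A > 0\<close> making
  \<open>alphaQ\<close> the positive one; \<open>t\<close> is minus the conjugate root. The
  factorization \<open>A*(X - y)*(X + t)\<close> reduces later sign questions to linear
  factors.\<close>

lemma simple_factor:
  assumes "Gp_simple (A,B,C)"
  obtains t where "A > 0" "t > 0" "alphaQ (A,B,C) > 0"
    "B = A*(t - alphaQ (A,B,C))" "C = - A*alphaQ (A,B,C)*t"
proof -
  define r where "r = sqrt (B\<^sup>2 - 4*A*C)"
  have AC: "A > 0" "C < 0" using assms by auto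
  then have "A*C < 0" by (simp add: mult_pos_neg)
  then have D: "B\<^sup>2 - 4*A*C > B\<^sup>2" by simp
  have rr: "r\<^sup>2 = B\<^sup>2 - 4*A*C" unfolding r_def using D
    by (smt (verit) real_sqrt_pow2 zero_le_power2)
  have "r > \<bar>B\<bar>" unfolding r_def using D real_sqrt_less_mono[OF D] by simp
  then have r: "- B + r > 0" "B + r > 0" by auto
  define y where "y = (- B + r)/(2*A)"
  define t where "t = (B + r)/(2*A)"
  have y: "alphaQ (A,B,C) = y" by (simp add: y_def r_def)
  have yt: "2*A*y = - B + r" "2*A*t = B + r" using AC by (auto simp: y_def t_def)
  have "4*A*(C + A*y*t) = 0" using yt rr by algebra
  then have "C = - A*y*t" using AC by simp
  moreover have "B = A*(t - y)" using yt by (simp add: algebra_simps)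
  moreover have "y > 0" "t > 0" using r AC by (auto simp: y_def t_def)
  ultimately show ?thesis using that[of t] AC y by simp
qed

lemma simple_disc: "Gp_simple Q \<Longrightarrow> disc Q > 0"
proof -
  assume a: "Gp_simple Q"
  obtain A B C where Q: "Q = (A,B,C)" by (metis surj_pair)
  have "A*C < 0" using a Q by (simp add: mult_pos_neg)
  then have "4 * (A*C) < B\<^sup>2" using zero_le_power2[of B] by linarith
  then show ?thesis using Q by (simp add: mult.assoc)
qed

lemma simple_fst: "Gp_simple Q \<Longrightarrow> fst Q \<noteq> 0"
  by (cases Q) auto

lemma simple_alphaQ_pos: "Gp_simple Q \<Longrightarrow> alphaQ Q > 0"
  by (cases Q) (metis simple_factor)

subsection \<open>The coding of a point\<close>

locale hecke =
  fixes p :: nat and l :: real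
  assumes p3: "p \<ge> 3" and l_def: "l = 2 * cos (pi / real p)"
begin

text \<open>Chebyshev polynomials of the second kind at \<open>cos (pi/p)\<close>; up to sign these
  are the entries of the powers of \<open>Umat l\<close>.\<close>

definition s :: "nat \<Rightarrow> real" where
  "s k = sin (real k * (pi / p)) / sin (pi / p)"

lemma sin_pos: "sin (pi / p) > 0"
  using p3 by (intro sin_gt_zero) (auto simp: divide_less_eq)

lemma s_0 [simp]: "s 0 = 0"
  by (simp add: s_def)

lemma s_1 [simp]: "s (Suc 0) = 1"
  using sin_pos by (simp add: s_def)

lemma s_p: "s p = 0"
  using p3 by (simp add: s_def)

lemma s_pos: "0 < k \<Longrightarrow> k < p \<Longrightarrow> s k > 0"
  unfolding s_def using sin_pos p3
  by (intro divide_pos_pos sin_gt_zero) (auto simp: field_simps)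

lemma s_nonneg: "k \<le> p \<Longrightarrow> s k \<ge> 0"
  using s_pos[of k] s_p by (cases "k = 0 \<or> k = p") auto

lemma s_rec: "s (Suc (Suc k)) = l * s (Suc k) - s k"
proof -
  define t where "t = pi / p"
  have a: "sin (real k * t + t + t) = 2 * cos t * sin (real k * t + t) - sin (real k * t)"
    using sin_add[of "real k * t + t" t] sin_diff[of "real k * t + t" t] by simp
  have e: "real (Suc (Suc k)) * t = real k * t + t + t" "real (Suc k) * t = real k * t + t" for t
    by (auto simp: algebra_simps)
  have "sin (real (Suc (Suc k)) * t) = l * sin (real (Suc k) * t) - sin (real k * t)"
    unfolding e a by (simp add: l_def t_def)
  then show ?thesis unfolding s_def t_def[symmetric] by (simp add: diff_divide_distrib)
qed

lemma s_reflect: "k \<le> p \<Longrightarrow> s (p - k) = s k"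
  using p3 by (simp add: s_def of_nat_diff diff_divide_distrib left_diff_distrib sin_diff)

text \<open>The recurrence makes the left side independent of \<open>i\<close>. Its sign orders the
  points U^k(0), and \<open>d = 1\<close> gives the determinant of \<open>H j\<close>.\<close>

lemma s_cross: "s (Suc i) * s (i + d) - s i * s (Suc (i + d)) = s d"
proof (induction i)
  case (Suc i)
  then show ?case by (simp add: s_rec algebra_simps)
qed simp

lemma s_det: "s (Suc k) * s (Suc k) - s (Suc (Suc k)) * s k = 1"
  using s_cross[of k 1] by (simp add: algebra_simps)

lemma l_pos: "l > 0"
proof -
  have "s (Suc (Suc 0)) > 0" using p3 by (intro s_pos) auto
  then show ?thesis by (simp add: s_rec)
qed

lemma U_mpow: "mpow (Umat l) (Suc k) = (s (Suc (Suc k)), - s (Suc k), s (Suc k), - s k)"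
proof (induction k)
  case 0
  then show ?case by (simp add: s_rec Umat_def Smat_def Tmat_def)
next
  case (Suc k)
  have "mpow (Umat l) (Suc (Suc k)) = mmul (Umat l) (mpow (Umat l) (Suc k))" by simp
  also have "\<dots> = mmul (Umat l) (s (Suc (Suc k)), - s (Suc k), s (Suc k), - s k)"
    by (simp only: Suc)
  finally show ?case using s_rec[of "Suc k"] s_rec[of k] by (simp add: Umat_def Smat_def Tmat_def)
qed

lemma U_p: "mpow (Umat l) p = mneg mid"
proof -
  obtain q where q: "p = Suc (Suc q)" using p3 by (metis Suc_le_D numeral_3_eq_3 Suc_le_mono)
  have "s (p - 1) = 1" using s_reflect[of 1] p3 by simp
  then have "s (Suc q) = 1" by (simp add: q)
  then have "s (Suc p) = -1" using s_rec[of "Suc q"] s_p q by simp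
  then show ?thesis using U_mpow[of "Suc q"] s_p \<open>s (Suc q) = 1\<close> q by (simp add: mid_def)
qed

text \<open>Only used for \<open>j \<ge> 1\<close>, where the subtraction does not truncate.\<close>
definition H :: "nat \<Rightarrow> mat2" where
  "H j = (s j, s (Suc j), s (j - 1), s j)"

text \<open>The interval from U^(j+1)(0) to U^j(0) with denominators cleared. For
  \<open>j = 1\<close> the upper condition reads \<open>0 < 1\<close>, which covers the endpoint
  infinity. The exponent used by \<open>Phi\<close> is \<open>p - j\<close>.\<close>

definition dig :: "nat \<Rightarrow> real \<Rightarrow> bool" where
  "dig j x \<longleftrightarrow> 1 \<le> j \<and> j < p \<and> s (Suc j) \<le> s j * x \<and> s (j - 1) * x < s j"

text \<open>Take the least \<open>j\<close> whose lower endpoint is at most \<open>x\<close>: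
  minimality against \<open>j - 1\<close> is the upper bound, and \<open>p - 1\<close> is a
  candidate because \<open>s p = 0\<close>.\<close>

lemma dig_ex: assumes "x \<ge> 0" shows "\<exists>j. dig j x"
proof -
  define j where "j = (LEAST j. s (Suc j) \<le> s j * x)"
  have "s (Suc (p - 1)) \<le> s (p - 1) * x"
    using p3 s_p assms s_nonneg[of "p - 1"] by simp
  then have 1: "s (Suc j) \<le> s j * x" "j \<le> p - 1"
    unfolding j_def by (rule LeastI, rule Least_le)
  have "j \<noteq> 0" using 1 by (cases "j = 0") auto
  then obtain i where i: "j = Suc i" by (cases j) auto
  have "\<not> (s (Suc i) \<le> s i * x)" using not_less_Least[of i "\<lambda>j. s (Suc j) \<le> s j * x"] i j_def by auto
  then show ?thesis using 1 i p3 unfolding dig_def by (intro exI[of _ j]) auto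
qed

lemma dig_unique_less: assumes "dig i x" "dig j x" "i < j" shows False
proof -
  obtain d where j: "j = Suc (i + d)" using assms(3) less_imp_Suc_add by blast
  have a: "s (Suc i) \<le> s i * x" "s (i + d) * x < s (Suc (i + d))" "1 \<le> i" "Suc (i + d) < p"
    using assms j unfolding dig_def by auto
  have p: "s i > 0" "s (i + d) > 0" "s d \<ge> 0" using a by (auto intro!: s_pos s_nonneg)
  have "s (i + d) * s (Suc i) \<le> s (i + d) * (s i * x)" using a p by (intro mult_left_mono) auto
  also have "\<dots> = s i * (s (i + d) * x)" by simp
  also have "\<dots> < s i * s (Suc (i + d))" using a p by (intro mult_strict_left_mono) auto
  finally show False using s_cross[of i d] p(3) by (simp add: algebra_simps)
qed

lemma dig_unique: "dig i x \<Longrightarrow> dig j x \<Longrightarrow> i = j"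
  by (metis dig_unique_less nat_neq_iff)

definition digit :: "real \<Rightarrow> nat" where
  "digit x = (THE j. dig j x)"

lemma digit_eq: "dig j x \<Longrightarrow> digit x = j"
  unfolding digit_def using dig_unique by blast

lemma dig_digit: "x \<ge> 0 \<Longrightarrow> dig (digit x) x"
  using dig_ex digit_eq by metis

lemma Upt_eq: "Upt l (Suc (Suc k)) = s (Suc (Suc k)) / s (Suc k)"
  unfolding Upt_def U_mpow by simp

lemma dig_iff_Upt:
  assumes "1 \<le> i" "i \<le> p - 1"
  shows "Upt l (p - i + 1) \<le> x \<and> (p - i = 1 \<or> x < Upt l (p - i)) \<longleftrightarrow> dig (p - i) x"
proof -
  obtain k where k: "p - i = Suc k" using assms p3 by (cases "p - i") auto
  have kp: "Suc k < p" using k assms by auto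
  have 1: "Upt l (p - i + 1) \<le> x \<longleftrightarrow> s (Suc (Suc k)) \<le> s (Suc k) * x"
    using k s_pos[of "Suc k"] kp by (simp add: Upt_eq field_simps)
  have 2: "(p - i = 1 \<or> x < Upt l (p - i)) \<longleftrightarrow> s k * x < s (Suc k)"
  proof (cases k)
    case (Suc m)
    then show ?thesis using k s_pos[of k] kp by (simp add: Upt_eq field_simps)
  qed (use k in simp)
  show ?thesis using 1 2 k kp by (simp add: dig_def)
qed

text \<open>The right side is the inverse of \<open>H j\<close>. The reflection
  \<open>s (p - k) = s k\<close> turns the entries of U^(p-j) into those of
  \<open>H j\<close>.\<close>

lemma Phi_eq:
  assumes "x \<ge> 0" "dig j x"
  shows "Phi p l x = (s j * x - s (Suc j)) / (s j - s (j - 1) * x)"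
proof -
  have j: "1 \<le> j" "j < p" using assms(2) by (auto simp: dig_def)
  have "(THE i. 1 \<le> i \<and> i \<le> p - 1 \<and> Upt l (p - i + 1) \<le> x
           \<and> (p - i = 1 \<or> x < Upt l (p - i))) = p - j"
  proof (rule the_equality)
    have "dig (p - (p - j)) x" using assms(2) j by simp
    then show "1 \<le> p - j \<and> p - j \<le> p - 1 \<and> Upt l (p - (p - j) + 1) \<le> x
           \<and> (p - (p - j) = 1 \<or> x < Upt l (p - (p - j)))"
      using j by (subst dig_iff_Upt) auto
  next
    fix i assume i: "1 \<le> i \<and> i \<le> p - 1 \<and> Upt l (p - i + 1) \<le> x
           \<and> (p - i = 1 \<or> x < Upt l (p - i))"
    then have "dig (p - i) x" using dig_iff_Upt by blast
    then have "p - i = j" using dig_unique assms(2) by blast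
    then show "i = p - j" using i j by auto
  qed
  then have P: "Phi p l x = mob (mmul Tmat (mpow (Umat l) (p - j))) x"
    unfolding Phi_def by simp
  obtain k where k: "p - j = Suc k" using j by (metis Suc_diff_Suc)
  have r: "s (Suc k) = s j" "s k = s (Suc j)" "s (Suc (Suc k)) = s (j - 1)"
    using s_reflect[of j] s_reflect[of "Suc j"] s_reflect[of "j - 1"] j k
    by (auto simp: Suc_diff_le diff_Suc split: nat.splits) 
  have "Phi p l x = (s j * - x + s (Suc j)) / (s (j - 1) * x - s j)"
    unfolding P k U_mpow by (simp add: Tmat_def r)
  also have "\<dots> = (- (s j * x - s (Suc j))) / (- (s j - s (j - 1) * x))" by simp
  also have "\<dots> = (s j * x - s (Suc j)) / (s j - s (j - 1) * x)"
    by (simp only: minus_divide_left[symmetric] minus_divide_right[symmetric] minus_minus)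
  finally show ?thesis .
qed

text \<open>The strict sign on the diagonal keeps \<open>c*x + d\<close> positive for all
  \<open>x \<ge> 0\<close>, so \<open>mob\<close> never meets a pole there.\<close>

definition posmat :: "mat2 \<Rightarrow> bool" where
  "posmat M = (case M of (a,b,c,d) \<Rightarrow> a > 0 \<and> d > 0 \<and> b \<ge> 0 \<and> c \<ge> 0 \<and> a*d - b*c = 1)"

lemma posmat_simp [simp]:
  "posmat (a,b,c,d) \<longleftrightarrow> a > 0 \<and> d > 0 \<and> b \<ge> 0 \<and> c \<ge> 0 \<and> a*d - b*c = 1"
  by (simp add: posmat_def)

lemma posmat_mdet: "posmat M \<Longrightarrow> mdet M = 1"
  by (cases M) auto

lemma posmat_mmul: "posmat M \<Longrightarrow> posmat N \<Longrightarrow> posmat (mmul M N)"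
proof -
  assume a: "posmat M" "posmat N"
  obtain a b c d e f g h where MN: "M = (a,b,c,d)" "N = (e,f,g,h)" by (metis surj_pair)
  have "mdet (mmul M N) = 1" using a by (simp add: posmat_mdet)
  moreover have "a*e + b*g > 0" using a MN by (intro add_pos_nonneg) auto
  moreover have "c*f + d*h > 0" using a MN by (intro add_nonneg_pos) auto
  ultimately show ?thesis using a MN by auto
qed

lemma mob_mmul:
  assumes "posmat N" "x \<ge> 0"
  shows "mob (mmul M N) x = mob M (mob N x)"
proof -
  obtain a b c d e f g h where MN: "M = (a,b,c,d)" "N = (e,f,g,h)" by (metis surj_pair)
  have k: "g*x + h > 0" using assms MN by (auto intro!: add_nonneg_pos)
  have "a * ((e*x+f)/(g*x+h)) + b = ((a*e+b*g)*x + (a*f+b*h)) / (g*x+h)"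
    "c * ((e*x+f)/(g*x+h)) + d = ((c*e+d*g)*x + (c*f+d*h)) / (g*x+h)"
    using k by (simp_all add: add_divide_eq_iff divide_add_eq_iff field_simps)
  then show ?thesis using MN k by simp
qed

lemma mob_nonneg: "posmat M \<Longrightarrow> x \<ge> 0 \<Longrightarrow> mob M x \<ge> 0"
  by (cases M) auto

lemma posmat_H: assumes "1 \<le> j" "j < p" shows "posmat (H j)"
proof -
  obtain k where "j = Suc k" using assms(1) by (cases j) auto
  then show ?thesis
    using s_det[of k] s_pos[of j] s_nonneg[of "Suc j"] s_nonneg[of k] assms by (auto simp: H_def)
qed

primrec hw :: "nat list \<Rightarrow> mat2" where
  "hw [] = mid"
| "hw (j # v) = mmul (H j) (hw v)"

abbreviation word :: "nat list \<Rightarrow> bool" where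
  "word v \<equiv> set v \<subseteq> {1..<p}"

lemma posmat_mid: "posmat mid"
  by (simp add: mid_def)

lemma posmat_hw: "word v \<Longrightarrow> posmat (hw v)"
  by (induction v) (auto simp: posmat_H posmat_mmul posmat_mid)

lemma hw_append: "hw (u @ v) = mmul (hw u) (hw v)"
  by (induction u) (auto simp: mmul_assoc)

text \<open>With \<open>m\<close> the denominator of \<open>H j\<close> at \<open>y\<close>, the two
  differences that decide the digit are \<open>y / m\<close> and \<open>1 / m\<close>; their
  quotient recovers \<open>y\<close>.\<close>

lemma H_dig:
  assumes "1 \<le> j" "j < p" "y \<ge> 0"
  shows "dig j (mob (H j) y)" "Phi p l (mob (H j) y) = y"
proof -
  obtain k where k: "j = Suc k" using assms(1) by (cases j) auto
  define x where "x = mob (H j) y"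
  have x: "x = (s (Suc k) * y + s (Suc (Suc k))) / (s k * y + s (Suc k))"
    by (simp add: x_def H_def k)
  have p: "s (Suc k) > 0" "s k \<ge> 0" "s (Suc (Suc k)) \<ge> 0"
    using assms k by (auto intro!: s_pos s_nonneg)
  define m where "m = s k * y + s (Suc k)"
  have m: "m > 0" using p assms(3) by (auto simp: m_def intro!: add_nonneg_pos)
  have mx: "m * x = s (Suc k) * y + s (Suc (Suc k))" using m unfolding x m_def[symmetric] by simp
  have a: "s (Suc k) * x - s (Suc (Suc k)) = y / m"
  proof -
    have "m * (s (Suc k) * x - s (Suc (Suc k))) = y"
      using mx s_det[of k] unfolding m_def by algebra
    then show ?thesis using m by (simp add: field_simps)
  qed
  have b: "s (Suc k) - s k * x = 1 / m"
  proof -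
    have "m * (s (Suc k) - s k * x) = 1"
      using mx s_det[of k] unfolding m_def by algebra
    then show ?thesis using m by (simp add: field_simps)
  qed
  have d: "dig j x"
  proof -
    have "s (Suc k) * x - s (Suc (Suc k)) \<ge> 0" "s (Suc k) - s k * x > 0"
      unfolding a b using m assms(3) by auto
    then show ?thesis unfolding dig_def using k assms by auto
  qed
  have "x \<ge> 0" unfolding x_def by (rule mob_nonneg[OF posmat_H]) (use assms in auto)
  then have "Phi p l x = y" using Phi_eq[OF _ d] a b m by (simp add: k)
  then show "dig j (mob (H j) y)" "Phi p l (mob (H j) y) = y" using d x_def by auto
qed

lemma Phi_step:
  assumes "x \<ge> 0"
  shows "Phi p l x \<ge> 0" "mob (H (digit x)) (Phi p l x) = x" "1 \<le> digit x" "digit x < p"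
proof -
  define j where "j = digit x"
  have d: "dig j x" using dig_digit[OF assms] j_def by simp
  then have j: "1 \<le> j" "j < p" by (auto simp: dig_def)
  then show "1 \<le> digit x" "digit x < p" by (auto simp: j_def)
  obtain k where k: "j = Suc k" using j(1) by (cases j) auto
  define m where "m = s (Suc k) - s k * x"
  have m: "m > 0" using d by (simp add: dig_def k m_def)
  define y where "y = (s (Suc k) * x - s (Suc (Suc k))) / m"
  have P: "Phi p l x = y" using Phi_eq[OF assms d] by (simp add: k y_def m_def)
  have y: "y \<ge> 0" using d m by (auto simp: dig_def k y_def)
  then show "Phi p l x \<ge> 0" using P by simp
  have my: "m * y = s (Suc k) * x - s (Suc (Suc k))" using m by (simp add: y_def)
  have 1: "m * (s k * y + s (Suc k)) = 1" "m * (s (Suc k) * y + s (Suc (Suc k))) = x"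
    using my s_det[of k] unfolding m_def by algebra+
  then have 2: "s k * y + s (Suc k) = 1 / m" "s (Suc k) * y + s (Suc (Suc k)) = x / m"
    using m by (auto simp: field_simps)
  have "mob (H j) y = (x / m) / (1 / m)" by (simp add: H_def k 2)
  then show "mob (H (digit x)) (Phi p l x) = x" using m by (simp add: P j_def)
qed

section \<open>Orbits and digit words\<close>

abbreviation it :: "nat \<Rightarrow> real \<Rightarrow> real" where
  "it k x \<equiv> (Phi p l ^^ k) x"

lemma it_nonneg: "x \<ge> 0 \<Longrightarrow> it k x \<ge> 0"
  by (induction k) (auto simp: Phi_step)

definition wd :: "real \<Rightarrow> nat \<Rightarrow> nat list" where
  "wd x k = map (\<lambda>i. digit (it i x)) [0..<k]"

lemma wd_0 [simp]: "wd x 0 = []"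
  by (simp add: wd_def)

lemma length_wd [simp]: "length (wd x k) = k"
  by (simp add: wd_def)

lemma wd_Suc: "wd x (Suc k) = wd x k @ [digit (it k x)]"
  by (simp add: wd_def)

lemma it_add: "it m (it k x) = it (k + m) x"
  by (metis add.commute comp_apply funpow_add)

lemma wd_add: "wd x (k + m) = wd x k @ wd (it k x) m"
  by (induction m) (auto simp: wd_Suc it_add)

lemma wd_Suc_left: "wd x (Suc k) = digit x # wd (Phi p l x) k"
  using wd_add[of x 1 k] by (simp add: wd_Suc)

lemma word_wd: "x \<ge> 0 \<Longrightarrow> word (wd x k)"
  using Phi_step(3,4)[OF it_nonneg] by (auto simp: wd_def Suc_le_eq)

lemma mob_mid [simp]: "mob mid x = x"
  by (simp add: mid_def)

lemma mob_hw_wd: "x \<ge> 0 \<Longrightarrow> mob (hw (wd x k)) (it k x) = x"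
proof (induction k arbitrary: x)
  case (Suc k)
  have y: "Phi p l x \<ge> 0" using Phi_step(1)[OF Suc.prems] .
  have "mob (hw (wd x (Suc k))) (it (Suc k) x) =
      mob (H (digit x)) (mob (hw (wd (Phi p l x) k)) (it k (Phi p l x)))"
    by (simp add: wd_Suc_left mob_mmul[OF posmat_hw[OF word_wd[OF y]] it_nonneg[OF y]] funpow_swap1)
  then show ?case using Suc.IH[OF y] Phi_step(2)[OF Suc.prems] by simp
qed simp

text \<open>Peels off one letter at a time by \<open>H_dig\<close>. It is the tool for recognizing a
  word found algebraically as an initial part of the coding.\<close>

lemma coding_unique:
  assumes "word v" "y \<ge> 0" "x = mob (hw v) y"
  shows "wd x (length v) = v \<and> it (length v) x = y"
  using assms
proof (induction v arbitrary: x)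
  case (Cons j v)
  define z where "z = mob (hw v) y"
  have z: "z \<ge> 0" using Cons.prems by (auto simp: z_def intro!: mob_nonneg posmat_hw)
  have IH: "wd z (length v) = v" "it (length v) z = y" using Cons by (auto simp: z_def)
  have x: "x = mob (H j) z" using Cons.prems by (simp add: z_def mob_mmul posmat_hw)
  then have "digit x = j" "Phi p l x = z"
    using H_dig[of j z] z Cons.prems(1) digit_eq by auto
  then show ?case using IH by (simp add: wd_Suc_left funpow_swap1)
qed simp

lemma H_eq_UT: assumes "1 \<le> j" shows "peq (H j) (mmul (mpow (Umat l) j) Tmat)"
proof -
  obtain k where k: "j = Suc k" using assms by (cases j) auto
  show ?thesis unfolding k U_mpow by (simp add: H_def Tmat_def peq_def)
qed

lemma hw_in_Gp: "word v \<Longrightarrow> hw v \<in> Gp l"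
proof (induction v)
  case (Cons j v)
  have "mmul (mpow (Umat l) j) Tmat \<in> Gp l" by (intro Gp_mmul Gp_mpow Gp_U Gp_gens)
  then have "H j \<in> Gp l" using H_eq_UT[of j] Cons.prems by (auto simp: peq_def intro: Gp_mneg)
  then show ?case using Cons by (auto intro: Gp_mmul)
qed (simp add: Gp_id)

subsection \<open>Group elements acting on codings\<close>

text \<open>The two shapes are exchanged, up to sign, by left multiplication with T.\<close>

definition coded :: "mat2 \<Rightarrow> bool" where
  "coded M \<longleftrightarrow> (\<exists>v. word v \<and> (peq M (hw v) \<or> peq M (mmul Tmat (hw v))))"

definition absorbs :: "real \<Rightarrow> mat2 \<Rightarrow> bool" where
  "absorbs x N \<longleftrightarrow> (\<exists>k. coded (mmul N (hw (wd x k))))"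

lemma absorbs_peq: "absorbs x M \<Longrightarrow> peq N M \<Longrightarrow> absorbs x N"
  unfolding absorbs_def coded_def
  by (meson peq_mmul peq_refl peq_trans)

lemma absorbs_T: "absorbs x M \<Longrightarrow> absorbs x (mmul Tmat M)"
proof -
  have "peq (mmul Tmat N) (mmul Tmat (hw v))" if "peq N (hw v)" for N v
    using that by (simp add: peq_mmul)
  moreover have "peq (mmul Tmat N) (hw v)" if "peq N (mmul Tmat (hw v))" for N v
  proof -
    have "peq (mmul Tmat N) (mmul Tmat (mmul Tmat (hw v)))" using that by (simp add: peq_mmul)
    then show ?thesis by (simp add: mmul_assoc[symmetric] T_square)
  qed
  ultimately show "absorbs x M \<Longrightarrow> absorbs x (mmul Tmat M)"
    unfolding absorbs_def coded_def mmul_assoc by blast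
qed

lemma UT_H: "peq (mmul (Umat l) Tmat) (H 1)"
  using peq_sym[OF H_eq_UT[of 1]] by simp

lemma U_H: "1 \<le> j \<Longrightarrow> peq (mmul (Umat l) (H j)) (H (Suc j))"
proof -
  assume "1 \<le> j"
  then have "peq (mmul (Umat l) (H j)) (mmul (Umat l) (mmul (mpow (Umat l) j) Tmat))"
    by (intro peq_mmul H_eq_UT) auto
  also have "peq \<dots> (H (Suc j))" using peq_sym[OF H_eq_UT[of "Suc j"]] by (simp add: mmul_assoc)
  finally show ?thesis .
qed

lemma H_p: "peq (H p) Tmat"
  using H_eq_UT[of p] p3 U_p by simp

text \<open>U raises the leading letter, T counting as letter \<open>p\<close> and being followed by
  letter 1. For \<open>M\<close> trivial there may be no letter to raise.\<close>

lemma coded_U: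
  assumes "coded M" "\<not> peq M mid" shows "coded (mmul (Umat l) M)"
proof -
  obtain v where v: "word v" "peq M (hw v) \<or> peq M (mmul Tmat (hw v))"
    using assms(1) coded_def by blast
  from v(2) show ?thesis
  proof
    assume M: "peq M (mmul Tmat (hw v))"
    have "peq (mmul (Umat l) M) (mmul (Umat l) (mmul Tmat (hw v)))" using M by (simp add: peq_mmul)
    also have "\<dots> = mmul (mmul (Umat l) Tmat) (hw v)" by (simp add: mmul_assoc)
    also have "peq \<dots> (hw (1 # v))" using UT_H by (simp add: peq_mmul)
    finally show ?thesis using v(1) p3 unfolding coded_def by (intro exI[of _ "1 # v"]) auto
  next
    assume M: "peq M (hw v)"
    obtain j u where u: "v = j # u" using assms(2) M by (cases v) auto
    have j: "1 \<le> j" "j < p" "word u" using v(1) u by auto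
    have "peq (mmul (Umat l) M) (mmul (Umat l) (mmul (H j) (hw u)))" using M u by (simp add: peq_mmul)
    also have "\<dots> = mmul (mmul (Umat l) (H j)) (hw u)" by (simp add: mmul_assoc)
    also have "peq \<dots> (mmul (H (Suc j)) (hw u))" using U_H[OF j(1)] by (simp add: peq_mmul)
    finally have *: "peq (mmul (Umat l) M) (mmul (H (Suc j)) (hw u))" .
    show ?thesis
    proof (cases "Suc j = p")
      case True
      then have "peq (mmul (Umat l) M) (mmul Tmat (hw u))"
        using * H_p peq_mmul[OF H_p peq_refl[of "hw u"]] peq_trans by metis
      then show ?thesis using j unfolding coded_def by blast
    next
      case False
      then show ?thesis using * j unfolding coded_def by (intro exI[of _ "Suc j # u"]) auto
    qed
  qed
qed

lemma absorbs_U: assumes "x \<ge> 0" "absorbs x M" shows "absorbs x (mmul (Umat l) M)"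
proof -
  obtain k where k: "coded (mmul M (hw (wd x k)))" using assms(2) absorbs_def by blast
  show ?thesis
  proof (cases "peq (mmul M (hw (wd x k))) mid")
    case False
    then show ?thesis using coded_U[OF k] unfolding absorbs_def mmul_assoc by blast
  next
    case True
    define j where "j = digit (it k x)"
    have j: "1 \<le> j" "j < p" using Phi_step(3,4)[OF it_nonneg[OF assms(1)]] by (auto simp: j_def)
    \<comment> \<open>One more digit of \<open>x\<close> supplies the missing leading
      letter.\<close>
    have "mmul (mmul (Umat l) M) (hw (wd x (Suc k))) = mmul (Umat l) (mmul (mmul M (hw (wd x k))) (H j))"
      by (simp add: wd_Suc hw_append mmul_assoc j_def)
    also have "peq \<dots> (mmul (Umat l) (mmul mid (H j)))"
      using True by (intro peq_mmul) auto
    also have "peq \<dots> (H (Suc j))" using U_H j by simp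
    finally have *: "peq (mmul (mmul (Umat l) M) (hw (wd x (Suc k)))) (H (Suc j))" .
    have "coded (mmul (mmul (Umat l) M) (hw (wd x (Suc k))))"
    proof (cases "Suc j = p")
      case True
      then show ?thesis using peq_trans[OF *] H_p unfolding coded_def by (intro exI[of _ "[]"]) auto
    next
      case False
      then show ?thesis using * j unfolding coded_def by (intro exI[of _ "[Suc j]"]) auto
    qed
    then show ?thesis unfolding absorbs_def by blast
  qed
qed

lemma absorbs_mpow_U: "x \<ge> 0 \<Longrightarrow> absorbs x M \<Longrightarrow> absorbs x (mmul (mpow (Umat l) n) M)"
  by (induction n) (auto simp: absorbs_U mmul_assoc)

lemma S_eq: "Smat l = mneg (mmul (Umat l) Tmat)"
  by (simp add: Umat_def mmul_assoc T_square)

text \<open>Since U^p is -1, the inverse of U is a positive power of U up to sign, and positive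
  powers are what \<open>absorbs_U\<close> can handle.\<close>

lemma Sinv_eq: "peq (minv (Smat l)) (mmul Tmat (mpow (Umat l) (p - 1)))"
proof -
  have "mmul (Umat l) (mpow (Umat l) (p - 1)) = mneg mid"
    using U_p p3 mpow.simps(2)[of "Umat l" "p - 1"] by simp
  then have "mmul (minv (Umat l)) (mmul (Umat l) (mpow (Umat l) (p - 1))) = mneg (minv (Umat l))" by simp
  then have "mpow (Umat l) (p - 1) = mneg (minv (Umat l))" by simp
  then show ?thesis unfolding S_eq by (simp add: minv_mneg minv_mmul minv_T)
qed

lemma Gp_absorbs: "N \<in> Gp l \<Longrightarrow> x \<ge> 0 \<Longrightarrow> absorbs x N"
proof (induction rule: Gp.induct)
  case Gp_id
  have "coded (mmul mid (hw (wd x 0)))" unfolding coded_def by (intro exI[of _ "[]"]) simp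
  then show ?case unfolding absorbs_def by blast
next
  case (Gp_S M)
  have "absorbs x (mmul (Umat l) (mmul Tmat M))" using Gp_S by (intro absorbs_U absorbs_T)
  then show ?case by (rule absorbs_peq) (simp add: S_eq mmul_assoc)
next
  case (Gp_Sinv M)
  have "absorbs x (mmul Tmat (mmul (mpow (Umat l) (p - 1)) M))"
    using Gp_Sinv by (intro absorbs_mpow_U absorbs_T)
  then show ?case
    by (rule absorbs_peq) (use peq_mmul[OF Sinv_eq peq_refl[of M]] in \<open>simp add: mmul_assoc\<close>)
next
  case (Gp_T M)
  then show ?case by (simp add: absorbs_T)
next
  case (Gp_Tinv M)
  then have "absorbs x (mmul Tmat M)" by (simp add: absorbs_T)
  then show ?case by (rule absorbs_peq) (simp add: minv_T)
qed

lemma sends_posmat: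
  assumes "posmat M" "z \<ge> 0" shows "sends M z x \<longleftrightarrow> mob M z = x"
proof -
  obtain a b c d where M: "M = (a,b,c,d)" by (metis surj_pair)
  have "c*z + d > 0" using assms M by (auto intro!: add_nonneg_pos)
  then show ?thesis using M by (simp add: divide_eq_eq)
qed

text \<open>Applied with \<open>V\<close> a stabilizer element (\<open>x = y\<close>) it compares
  two initial words of one point; applied with \<open>V\<close> carrying one form to another it
  merges two orbits.\<close>

lemma Gp_merge:
  assumes "V \<in> Gp l" "y \<ge> 0" "x \<ge> 0" "sends V y x"
  obtains k v where "word v" "peq (mmul V (hw (wd y k))) (hw v)" "wd x (length v) = v"
    "it (length v) x = it k y"
proof -
  obtain k v where v: "word v" "peq (mmul V (hw (wd y k))) (hw v) \<or>
      peq (mmul V (hw (wd y k))) (mmul Tmat (hw v))"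
    using Gp_absorbs[OF assms(1,2)] unfolding absorbs_def coded_def by meson
  define z where "z = it k y"
  have z: "z \<ge> 0" using it_nonneg assms(2) by (simp add: z_def)
  have "sends (hw (wd y k)) z y"
    using sends_posmat[OF posmat_hw[OF word_wd[OF assms(2)]] z] mob_hw_wd[OF assms(2)] z_def by simp
  then have Vz: "sends (mmul V (hw (wd y k))) z x" using sends_mmul[OF _ assms(4)] by simp
  obtain e f g h where E: "hw v = (e,f,g,h)" by (metis surj_pair)
  have "posmat (e,f,g,h)" using posmat_hw[OF v(1)] E by simp
  then have ge: "g*z + h > 0" "e*z + f \<ge> 0" using z by (auto intro!: add_nonneg_pos add_nonneg_nonneg)
  \<comment> \<open>T after a nonnegative word takes \<open>z\<close> to a negative number or to
    infinity, but the image is \<open>x \<ge> 0\<close>.\<close>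
  have "\<not> peq (mmul V (hw (wd y k))) (mmul Tmat (hw v))"
  proof
    assume "peq (mmul V (hw (wd y k))) (mmul Tmat (hw v))"
    then have "sends (mmul Tmat (hw v)) z x" using Vz unfolding peq_def by (metis sends_mneg)
    then have "- (g*z + h) = x*(e*z + f)" by (simp add: E Tmat_def)
    moreover have "x*(e*z + f) \<ge> 0" using ge assms(3) by simp
    ultimately show False using ge by linarith
  qed
  then have p: "peq (mmul V (hw (wd y k))) (hw v)" using v(2) by blast
  then have "sends (hw v) z x" using Vz unfolding peq_def by (metis sends_mneg)
  then have "x = mob (hw v) z" using sends_posmat[OF posmat_hw[OF v(1)] z] by simp
  then have "wd x (length v) = v" "it (length v) x = z" using coding_unique[OF v(1) z] by auto
  then show ?thesis using that[OF v(1) p] z_def by simp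
qed

text \<open>All summands of the upper right entry are nonnegative, so each must vanish. This leaves
  only the letter \<open>p - 1\<close>, whose matrix is lower unipotent.\<close>

lemma hw_b0:
  assumes "word v" "hw v = (a,0,c,d)" shows "a = 1 \<and> d = 1"
  using assms
proof (induction v arbitrary: a c d)
  case (Cons j v)
  obtain e f g h where E: "hw v = (e,f,g,h)" by (metis surj_pair)
  have p: "posmat (e,f,g,h)" using posmat_hw[of v] Cons.prems E by simp
  have j: "1 \<le> j" "j < p" using Cons.prems by auto
  have sj: "s j > 0" "s (Suc j) \<ge> 0" using j by (auto intro: s_pos s_nonneg)
  have "s j * f + s (Suc j) * h = 0" using Cons.prems E by (simp add: H_def)
  moreover have "s j * f \<ge> 0" "s (Suc j) * h \<ge> 0" using p sj by auto
  ultimately have "s j * f = 0" "s (Suc j) * h = 0" by linarith+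
  then have f: "f = 0" "s (Suc j) = 0" using p sj by auto
  then have "j = p - 1" using s_pos[of "Suc j"] j by force
  then have "s j = 1" using s_reflect[of 1] p3 by simp
  moreover have "e = 1 \<and> h = 1" using Cons.IH[of e g h] Cons.prems E f by auto
  ultimately show ?case using Cons.prems E f by (simp add: H_def)
qed (simp add: mid_def)

lemma hw_c0:
  assumes "word v" "hw v = (a,b,0,d)" shows "a = 1 \<and> d = 1"
  using assms
proof (induction v arbitrary: a b d)
  case (Cons j v)
  obtain e f g h where E: "hw v = (e,f,g,h)" by (metis surj_pair)
  have p: "posmat (e,f,g,h)" using posmat_hw[of v] Cons.prems E by simp
  have j: "1 \<le> j" "j < p" using Cons.prems by auto
  have sj: "s j > 0" "s (j - 1) \<ge> 0" using j by (auto intro: s_pos s_nonneg)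
  have "s (j - 1) * e + s j * g = 0" using Cons.prems E by (simp add: H_def)
  moreover have "s j * g \<ge> 0" "s (j - 1) * e \<ge> 0" using p sj by auto
  ultimately have "s j * g = 0" "s (j - 1) * e = 0" by linarith+
  then have f: "g = 0" "s (j - 1) = 0" using p sj by auto
  then have "j = 1" using s_pos[of "j - 1"] j by force
  moreover have "e = 1 \<and> h = 1" using Cons.IH[of e f h] Cons.prems E f by auto
  ultimately show ?case using Cons.prems E f by (simp add: H_def)
qed (simp add: mid_def)

text \<open>The first letter decides: \<open>s (j - 1)\<close> vanishes only for
  \<open>j = 1\<close> and \<open>s (j + 1)\<close> only for \<open>j = p - 1\<close>, and these
  differ as \<open>p \<ge> 3\<close>.\<close>

lemma hw_nontrivial:
  assumes "word v" "v \<noteq> []" "hw v = (a,b,c,d)" shows "b > 0 \<or> c > 0"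
proof -
  obtain j u where v: "v = j # u" using assms(2) by (cases v) auto
  obtain e f g h where E: "hw u = (e,f,g,h)" by (metis surj_pair)
  have p: "posmat (e,f,g,h)" using posmat_hw[of u] assms v E by simp
  have j: "1 \<le> j" "j < p" using assms v by auto
  have sj: "s j > 0" "s (j - 1) \<ge> 0" "s (Suc j) \<ge> 0" using j by (auto intro: s_pos s_nonneg)
  have bc: "b = s j * f + s (Suc j) * h" "c = s (j - 1) * e + s j * g"
    using assms(3) v E by (auto simp: H_def)
  show ?thesis
  proof (cases "Suc j < p")
    case True
    then have "s (Suc j) * h > 0" using p s_pos by simp
    then have "b > 0" unfolding bc using p sj by (intro add_nonneg_pos) auto
    then show ?thesis ..
  next
    case False
    then have "s (j - 1) > 0" using p3 j by (intro s_pos) auto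
    then have "c > 0" unfolding bc using p sj by (intro add_pos_nonneg) auto
    then show ?thesis ..
  qed
qed

text \<open>Infinity is not fixed by a hyperbolic element, since 0 is coded by matrices \<open>H (p - 1)\<close> only.\<close>
lemma Gp_upper_triangular:
  assumes "(a,b,0,d) \<in> Gp l" shows "\<bar>a + d\<bar> = 2"
proof -
  have N: "mmul (a,b,0,d) Tmat \<in> Gp l" using assms by (intro Gp_mmul Gp_gens)
  have ad: "a*d = 1" using mdet_Gp[OF assms] by simp
  obtain k v where v: "word v" "peq (mmul (mmul (a,b,0,d) Tmat) (hw (wd 0 k))) (hw v) \<or>
      peq (mmul (mmul (a,b,0,d) Tmat) (hw (wd 0 k))) (mmul Tmat (hw v))"
    using Gp_absorbs[OF N, of 0] unfolding absorbs_def coded_def by auto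
  obtain a' b' c' d' where W: "hw (wd 0 k) = (a',b',c',d')" by (metis surj_pair)
  have w: "word (wd 0 k)" by (rule word_wd) simp
  have pw: "posmat (a',b',c',d')" using posmat_hw[OF w] W by simp
  define z where "z = it k 0"
  have z: "z \<ge> 0" by (simp add: z_def it_nonneg)
  have "sends (hw (wd 0 k)) z 0"
    using sends_posmat[OF posmat_hw[OF w] z] mob_hw_wd[of 0 k] z_def by simp
  then have "a'*z + b' = 0" using W by simp
  moreover have "a'*z \<ge> 0" using pw z by simp
  ultimately have b': "b' = 0" using pw by auto
  have 1: "a' = 1" "d' = 1" using hw_b0[OF w] W b' by auto
  obtain e f g h where E: "hw v = (e,f,g,h)" by (metis surj_pair)
  have p: "posmat (e,f,g,h)" using posmat_hw[OF v(1)] E by simp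
  \<comment> \<open>The product on the left has lower right entry 0. In \<open>hw v\<close> this
    entry is positive, so only T times \<open>hw v\<close> remains, where it is \<open>f\<close> and
    its neighbour is \<open>e\<close>.\<close>
  have "f = 0 \<and> \<bar>d\<bar> = e"
    using v(2) p by (auto simp: peq_def E W b' 1 Tmat_def)
  then have "\<bar>d\<bar> = 1" using hw_b0[OF v(1)] E by auto
  then show ?thesis using ad by (auto simp: abs_if split: if_splits)
qed

lemma Gp_hyperbolic_fst:
  assumes "M \<in> Gp l" "\<bar>mtrace M\<bar> > 2" shows "fst (form M) \<noteq> 0"
proof -
  obtain a b c d where M: "M = (a,b,c,d)" by (metis surj_pair)
  show ?thesis using Gp_upper_triangular[of a b d] assms M by auto
qed

subsection \<open>Hyperbolic forms\<close>

lemma stab_generatorD: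
  assumes "stab_generator l M x"
  shows "M \<in> Gp l" "mdet M = 1" "fixpol M x"
    "\<And>N. N \<in> Gp l \<Longrightarrow> fixpol N x \<Longrightarrow> \<exists>k. peq N (mzpow M k)"
proof -
  show M: "M \<in> Gp l" "mdet M = 1" using assms mdet_Gp unfolding stab_generator_def by blast+
  show "fixpol M x" using assms mfixes_iff_fixpol[OF M(2)] unfolding stab_generator_def by blast
  fix N assume N: "N \<in> Gp l" "fixpol N x"
  then have "mfixes N x" using mfixes_iff_fixpol[OF mdet_Gp] by blast
  then show "\<exists>k. peq N (mzpow M k)"
    using assms N unfolding stab_generator_def peq_def by blast
qed

lemma stab_generatorI:
  assumes "M \<in> Gp l" "fixpol M x"
    "\<And>N. N \<in> Gp l \<Longrightarrow> fixpol N x \<Longrightarrow> \<exists>k. peq N (mzpow M k)"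
  shows "stab_generator l M x"
  unfolding stab_generator_def
proof (intro conjI ballI impI)
  show "M \<in> Gp l" "mfixes M x" using assms mfixes_iff_fixpol[OF mdet_Gp] by auto
  fix N assume "N \<in> Gp l" "mfixes N x"
  then show "\<exists>k. N = mzpow M k \<or> N = mneg (mzpow M k)"
    using assms(3) mfixes_iff_fixpol[OF mdet_Gp] unfolding peq_def by blast
qed

lemma peq_ln_mu: "peq M N \<Longrightarrow> ln \<bar>mu x M\<bar> = ln \<bar>mu x N\<bar>"
  by (auto simp: peq_def)

text \<open>\<open>hyperbolic\<close> provides only some hyperbolic stabilizer element. Up to sign
  it is a power of the generator, so additivity of \<open>ln |mu|\<close> makes the generator
  hyperbolic too.\<close>

lemma hyperbolic_iff:
  "hyperbolic l Q \<longleftrightarrow> (\<exists>M. stab_generator l M (alphaQ Q) \<and> \<bar>mtrace M\<bar> > 2 \<and> Q = form M)"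
proof
  assume "hyperbolic l Q"
  then obtain \<alpha> a b c d N where N: "N \<in> Gp l" "mfixes N \<alpha>" "\<bar>mtrace N\<bar> > 2"
    and M: "stab_generator l (a,b,c,d) \<alpha>"
    and \<alpha>: "\<alpha> = (a - d + sqrt ((a+d)^2 - 4)) / (2*c)" and Q: "Q = (c, d - a, -b)"
    unfolding hyperbolic_def by blast
  define M where "M = (a,b,c,d)"
  have m: "M \<in> Gp l" "mdet M = 1" "fixpol M \<alpha>" using stab_generatorD[OF M] M_def by auto
  have dN: "mdet N = 1" using N mdet_Gp by blast
  have fN: "fixpol N \<alpha>" using N mfixes_iff_fixpol[OF dN] by blast
  obtain k where k: "peq N (mzpow M k)" using stab_generatorD(4)[OF M N(1) fN] M_def by blast
  have "ln \<bar>mu \<alpha> N\<bar> \<noteq> 0" using abs_trace_gt_2_iff[OF dN fN] N(3) by simp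
  moreover have "ln \<bar>mu \<alpha> N\<bar> = of_int k * ln \<bar>mu \<alpha> M\<bar>"
    using peq_ln_mu[OF k] ln_mu_mzpow[OF m(2,3)] by simp
  ultimately have "ln \<bar>mu \<alpha> M\<bar> \<noteq> 0" by auto
  then have t: "\<bar>mtrace M\<bar> > 2" using abs_trace_gt_2_iff[OF m(2,3)] by blast
  have "(d - a)\<^sup>2 - 4*c*(-b) = (a+d)\<^sup>2 - 4" using disc_form[OF m(2)] by (simp add: M_def)
  then have "alphaQ Q = \<alpha>" unfolding \<alpha> Q by simp
  then show "\<exists>M. stab_generator l M (alphaQ Q) \<and> \<bar>mtrace M\<bar> > 2 \<and> Q = form M"
    using M t Q form_simp[of a b c d] unfolding M_def by metis
next
  assume "\<exists>M. stab_generator l M (alphaQ Q) \<and> \<bar>mtrace M\<bar> > 2 \<and> Q = form M"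
  then obtain M where M: "stab_generator l M (alphaQ Q)" "\<bar>mtrace M\<bar> > 2" "Q = form M" by blast
  obtain a b c d where abcd: "M = (a,b,c,d)" by (metis surj_pair)
  note m = stab_generatorD(1,2)[OF M(1)]
  have f: "mfixes M (alphaQ Q)" using stab_generatorD(3)[OF M(1)] mfixes_iff_fixpol[OF m(2)] by blast
  have "(d - a)\<^sup>2 - 4*c*(-b) = (a+d)\<^sup>2 - 4" using disc_form[OF m(2)] abcd by simp
  then have a: "alphaQ Q = (a - d + sqrt ((a+d)^2 - 4)) / (2*c)" using M(3) abcd by simp
  have "stab_generator l (a,b,c,d) (alphaQ Q)" "Q = (c, d - a, -b)" using M abcd by simp_all
  then show "hyperbolic l Q" unfolding hyperbolic_def
    using m(1) f M(2) a by blast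
qed

lemma hyperbolic_fst: "hyperbolic l Q \<Longrightarrow> fst Q \<noteq> 0"
  unfolding hyperbolic_iff using Gp_hyperbolic_fst stab_generatorD(1) by blast

lemma gt_2_square: "\<bar>t\<bar> > 2 \<Longrightarrow> t\<^sup>2 - 4 > (0::real)"
  using power_strict_mono[of 2 "\<bar>t\<bar>" 2] by simp

lemma hyperbolic_disc: "hyperbolic l Q \<Longrightarrow> disc Q > 0"
  unfolding hyperbolic_iff using disc_form stab_generatorD(2) gt_2_square by metis

text \<open>Substituting \<open>V\<close> conjugates the generator, and with it the stabilizer. The
  leading coefficient stays nonzero because no hyperbolic element fixes infinity.\<close>

lemma hyperbolic_fcomp:
  assumes "hyperbolic l Q" "V \<in> Gp l"
  shows "hyperbolic l (fcomp Q V)" "sends V (alphaQ (fcomp Q V)) (alphaQ Q)"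
proof -
  obtain M where M: "stab_generator l M (alphaQ Q)" "\<bar>mtrace M\<bar> > 2" "Q = form M"
    using assms(1) hyperbolic_iff by blast
  have dV: "mdet V = 1" using mdet_Gp assms(2) by blast
  define M' where "M' = mmul (minv V) (mmul M V)"
  define y where "y = alphaQ (fcomp Q V)"
  have Q': "fcomp Q V = form M'" using form_conj[OF dV] M(3) M'_def by simp
  have M'G: "M' \<in> Gp l" unfolding M'_def using Gp_conj stab_generatorD(1)[OF M(1)] assms(2) by blast
  have t: "\<bar>mtrace M'\<bar> > 2" using mtrace_conj[OF dV] M(2) M'_def by simp
  have nz: "fst (fcomp Q V) \<noteq> 0" using Gp_hyperbolic_fst[OF M'G t] Q' by simp
  show sy: "sends V (alphaQ (fcomp Q V)) (alphaQ Q)"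
    by (rule alphaQ_fcomp[OF dV less_imp_le[OF hyperbolic_disc[OF assms(1)]] hyperbolic_fst[OF assms(1)] nz])
  have sM: "sends M (alphaQ Q) (alphaQ Q)" using stab_generatorD(3)[OF M(1)] sends_self by blast
  have "fixpol M' y"
    unfolding sends_self[symmetric] M'_def y_def
    by (rule sends_mmul[OF sends_mmul[OF sy sM] sends_minv[OF dV sy]])
  moreover have "\<exists>k. peq N (mzpow M' k)" if N: "N \<in> Gp l" "fixpol N y" for N
  proof -
    define N' where "N' = mmul V (mmul N (minv V))"
    have "N' \<in> Gp l" unfolding N'_def using N(1) assms(2) by (intro Gp_mmul Gp_minv)
    moreover have "sends N' (alphaQ Q) (alphaQ Q)"
      unfolding N'_def using N(2) unfolding y_def sends_self[symmetric]
      by (rule sends_mmul[OF sends_mmul[OF sends_minv[OF dV sy]] sy])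
    ultimately obtain k where "peq N' (mzpow M k)"
      using stab_generatorD(4)[OF M(1)] sends_self by blast
    then have "peq (mmul (minv V) (mmul N' V)) (mzpow M' k)"
      unfolding M'_def mzpow_conj[OF dV] by (intro peq_mmul) auto
    moreover have "mmul (minv V) (mmul N' V) = N" by (simp add: N'_def mmul_assoc dV)
    ultimately show ?thesis by auto
  qed
  ultimately have "stab_generator l M' y" using M'G by (intro stab_generatorI)
  then show "hyperbolic l (fcomp Q V)" unfolding hyperbolic_iff using t Q' y_def by blast
qed

lemma form_minv: "form (minv M) = form (mneg M)"
  by (cases M) simp

lemma form_mneg_minv: "form (mneg (minv M)) = form M"
  by (cases M) simp

text \<open>Two generators are powers of each other, with exponents of product 1 by additivity of
  \<open>ln |mu|\<close>, so they agree up to sign and inversion. A negated form would have the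
  conjugate root as its \<open>alphaQ\<close>.\<close>

lemma hyperbolic_eqI:
  assumes "hyperbolic l Q" "hyperbolic l R" "alphaQ Q = alphaQ R" shows "Q = R"
proof -
  obtain M where M: "stab_generator l M (alphaQ Q)" "\<bar>mtrace M\<bar> > 2" "Q = form M"
    using assms(1) hyperbolic_iff by blast
  obtain N where N: "stab_generator l N (alphaQ Q)" "\<bar>mtrace N\<bar> > 2" "R = form N"
    using assms(2) unfolding hyperbolic_iff assms(3) by blast
  note m = stab_generatorD[OF M(1)] and n = stab_generatorD[OF N(1)]
  obtain i j where ij: "peq N (mzpow M i)" "peq M (mzpow N j)"
    using m(4)[OF n(1,3)] n(4)[OF m(1,3)] by blast
  define L where "L K = ln \<bar>mu (alphaQ Q) K\<bar>" for K
  have "L N = of_int i * L M"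
    unfolding L_def by (rule trans[OF peq_ln_mu[OF ij(1)] ln_mu_mzpow[OF m(2,3)]])
  moreover have "L M = of_int j * L N"
    unfolding L_def by (rule trans[OF peq_ln_mu[OF ij(2)] ln_mu_mzpow[OF n(2,3)]])
  moreover have "L M \<noteq> 0" using abs_trace_gt_2_iff[OF m(2,3)] M(2) unfolding L_def by blast
  ultimately have "real_of_int (i * j) = 1" by simp
  then have "i * j = 1" by (simp only: of_int_eq_1_iff)
  then have "i = 1 \<or> i = - 1" by (auto simp: zmult_eq_1_iff)
  then have "peq N M \<or> peq N (minv M)" using ij(1) by (auto simp: mzpow_def)
  then have "form N = form M \<or> form N = form (mneg M)" by (auto simp: peq_def form_minv form_mneg_minv)
  moreover have "form N \<noteq> form (mneg M)"
  proof
    assume e: "form N = form (mneg M)"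
    obtain A B C where A: "Q = (A,B,C)" by (metis surj_pair)
    have R: "R = (-A,-B,-C)" using e A M(3) N(3) by (cases M) auto
    have "2*A*alphaQ Q + B = sqrt (disc Q)"
      using alphaQ_iff[of A B C "alphaQ Q"] hyperbolic_fst[OF assms(1)] A by simp
    moreover have "2*(-A)*alphaQ Q + (-B) = sqrt (disc R)"
      using alphaQ_iff[of "-A" "-B" "-C" "alphaQ Q"] hyperbolic_fst[OF assms(2)] R assms(3) by simp
    moreover have "sqrt (disc Q) > 0" "sqrt (disc R) > 0"
      using hyperbolic_disc assms by auto
    ultimately show False by simp
  qed
  ultimately show ?thesis using M N by simp
qed

subsection \<open>Periodic points\<close>

lemma Phi_0: "Phi p l 0 = 0"
proof -
  have "mob (H (p - 1)) 0 = 0" using p3 s_p by (simp add: H_def)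
  then show ?thesis using H_dig(2)[of "p - 1" 0] p3 by simp
qed

lemma it_0: "it k 0 = 0"
  by (induction k) (auto simp: Phi_0)

lemma it_period: "it n x = x \<Longrightarrow> it (q * n) x = x"
  by (induction q) (simp_all add: it_add[symmetric] add.commute)

text \<open>0 is fixed by \<open>Phi\<close>, so an orbit that reaches it cannot return to
  \<open>x\<close>.\<close>

lemma it_periodic_pos:
  assumes "x > 0" "n \<ge> 1" "it n x = x" shows "it k x > 0"
proof (rule ccontr)
  assume "\<not> it k x > 0"
  then have "it k x = 0" using it_nonneg[of x k] assms(1) by simp
  then have "it (k + (k * n - k)) x = 0" unfolding it_add[symmetric] by (simp add: it_0)
  moreover have "k + (k * n - k) = k * n" using assms(2) by simp
  ultimately show False using it_period[OF assms(3), of k] assms(1) by simp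
qed

lemma it_orbit_period: "it n x = x \<Longrightarrow> it n (it k x) = it k x"
  by (metis it_add add.commute)

lemma hw_wd_period: "it n x = x \<Longrightarrow> hw (wd x (q * n)) = mpow (hw (wd x n)) q"
  by (induction q) (simp_all add: wd_add hw_append)

lemma orbit_set:
  assumes "n \<ge> 1" "it n x = x" shows "{it k x | k. k < n} = range (\<lambda>k. it k x)"
proof -
  have "it k x = it (k mod n) x" for k
  proof -
    have "it k x = it (k mod n) (it (k div n * n) x)" unfolding it_add by simp
    then show ?thesis using it_period[OF assms(2)] by simp
  qed
  moreover have "k mod n < n" for k using assms(1) by simp
  ultimately show ?thesis by blast
qed

definition pform :: "nat \<Rightarrow> real \<Rightarrow> bqf" where
  "pform n x = form (hw (wd x n))"

lemma sends_hw_wd: "x \<ge> 0 \<Longrightarrow> sends (hw (wd x k)) (it k x) x"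
  using sends_posmat[OF posmat_hw[OF word_wd] it_nonneg] mob_hw_wd by simp

text \<open>The initial product of length \<open>n + k\<close> splits in two ways, as period then
  prefix or prefix then shifted period; hence the two period matrices are conjugate by the
  prefix.\<close>

lemma pform_shift:
  assumes "x \<ge> 0" "it n x = x"
  shows "pform n (it k x) = fcomp (pform n x) (hw (wd x k))"
proof -
  define V where "V = hw (wd x k)"
  have dV: "mdet V = 1" unfolding V_def by (intro posmat_mdet posmat_hw word_wd assms)
  have "mmul (hw (wd x n)) V = hw (wd x (n + k))" by (simp add: wd_add hw_append V_def assms)
  also have "\<dots> = mmul V (hw (wd (it k x) n))"
    using wd_add[of x k n] by (simp add: hw_append V_def add.commute)
  finally have "mmul (minv V) (mmul (hw (wd x n)) V) = hw (wd (it k x) n)" using dV by simp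
  then show ?thesis unfolding pform_def V_def[symmetric] form_conj[OF dV] by simp
qed

lemma pform_props:
  assumes "x > 0" "n \<ge> 1" "it n x = x"
  shows "Gp_simple (pform n x)" "alphaQ (pform n x) = x" "\<bar>mtrace (hw (wd x n))\<bar> > 2"
    "fixpol (hw (wd x n)) x"
proof -
  have w: "word (wd x n)" using assms by (intro word_wd) auto
  obtain a b c d where M: "hw (wd x n) = (a,b,c,d)" by (metis surj_pair)
  have p: "a > 0" "d > 0" "b \<ge> 0" "c \<ge> 0" "a*d - b*c = 1" using posmat_hw[OF w] M by auto
  have "sends (hw (wd x n)) x x" using sends_hw_wd[of x n] assms by simp
  then show f: "fixpol (hw (wd x n)) x" by (simp add: sends_self)
  then have fx: "a*x + b = x*(c*x + d)" using M by simp
  have nt: "b > 0 \<or> c > 0" using hw_nontrivial[OF w _ M] assms(2) by (metis length_wd list.size(3) not_one_le_zero)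
  \<comment> \<open>A word with a zero off-diagonal entry is unipotent. A nontrivial one fixes only
    0 among the reals if \<open>b = 0\<close>, and is a translation without real fixed point if
    \<open>c = 0\<close>.\<close>
  have b: "b > 0"
  proof (rule ccontr)
    assume "\<not> b > 0"
    then have b0: "b = 0" using p by simp
    then have "a = 1" "d = 1" using hw_b0[OF w] M by auto
    then have "c * (x*x) = 0" using fx b0 by (simp add: algebra_simps)
    then show False using assms(1) nt b0 by simp
  qed
  have c: "c > 0"
  proof (rule ccontr)
    assume "\<not> c > 0"
    then have c0: "c = 0" using p by simp
    then have "a = 1" "d = 1" using hw_c0[OF w] M by auto
    then show False using fx b c0 by simp
  qed
  show "Gp_simple (pform n x)" using b c by (simp add: pform_def M)
  \<comment> \<open>Minus the conjugate fixed point: the roots of the form have product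
    \<open>-b/c\<close>.\<close>
  define t where "t = b/(c*x)"
  have t: "t > 0" using b c assms(1) by (simp add: t_def)
  have 1: "- b = - c*x*t" using c assms(1) by (simp add: t_def)
  have "x * (d - a) = x * (c*(t-x))" using fx 1 by algebra
  then have 2: "d - a = c*(t-x)" using assms(1) by simp
  show "alphaQ (pform n x) = x" unfolding pform_def M form_simp 2 1
    by (rule alphaQ_factor[OF c assms(1) t])
  have "b*c > 0" using b c by simp
  then have "(a+d)\<^sup>2 > 2\<^sup>2 + (a-d)\<^sup>2" using p(5) by (simp add: power2_eq_square algebra_simps)
  then have "(a+d)\<^sup>2 > 2\<^sup>2" using zero_le_power2[of "a - d"] by linarith
  then have "a + d > 2" by (rule power_less_imp_less_base) (use p in simp)
  then show "\<bar>mtrace (hw (wd x n))\<bar> > 2" by (simp add: M)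
qed

lemma period_generator:
  assumes "x > 0" "n \<ge> 1" "it n x = x" "\<And>m. 1 \<le> m \<Longrightarrow> m < n \<Longrightarrow> it m x \<noteq> x"
  shows "stab_generator l (hw (wd x n)) x"
proof (rule stab_generatorI)
  define M where "M = hw (wd x n)"
  have x0: "x \<ge> 0" using assms(1) by simp
  show "hw (wd x n) \<in> Gp l" by (intro hw_in_Gp word_wd x0)
  show "fixpol (hw (wd x n)) x" by (rule pform_props(4)[OF assms(1-3)])
  have dM: "mdet M = 1" unfolding M_def by (intro posmat_mdet posmat_hw word_wd x0)
  \<comment> \<open>Two prefixes ending at the same orbit point have lengths differing by a multiple
    of the minimal period, so they differ by a left power of \<open>M\<close>.\<close>
  have key: "\<exists>q. hw (wd x m) = mmul (mpow M q) (hw (wd x k))" if km: "k \<le> m" "it k x = it m x" for k m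
  proof -
    \<comment> \<open>Running \<open>k*n - k\<close> further steps from the common point completes
      \<open>k\<close> to a multiple of the period; this brings the orbit back to
      \<open>x\<close>.\<close>
    have "k * 1 \<le> k * n" using assms(2) by (rule mult_le_mono2)
    then have nk: "k + (k * n - k) = k * n" by simp
    have "it (m - k) x = it (m - k) (it (k * n) x)" by (simp add: it_period assms(3))
    also have "\<dots> = it (k * n - k) (it m x)"
    proof -
      have "k * n + (m - k) = m + (k * n - k)" using km(1) nk by linarith
      then show ?thesis unfolding it_add by (rule arg_cong)
    qed
    also have "\<dots> = it (k * n) x" unfolding km(2)[symmetric] it_add nk ..
    finally have 1: "it (m - k) x = x" by (simp add: it_period assms(3))
    define r where "r = (m - k) mod n"
    define q where "q = (m - k) div n"
    have mk: "m - k = q * n + r" by (simp add: q_def r_def)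
    have "it r x = it r (it (q * n) x)" by (simp add: it_period assms(3))
    also have "\<dots> = it (m - k) x" unfolding it_add mk ..
    finally have "it r x = x" using 1 by simp
    moreover have "r < n" using assms(2) by (simp add: r_def)
    ultimately have "r = 0" using assms(4)[of r] by (cases "r = 0") auto
    then have m: "m = q * n + k" using mk km(1) by simp
    have "hw (wd x m) = mmul (mpow M q) (hw (wd x k))"
      unfolding m wd_add hw_append hw_wd_period[OF assms(3)] it_period[OF assms(3)] M_def ..
    then show ?thesis ..
  qed
  fix N assume N: "N \<in> Gp l" "fixpol N x"
  obtain k v where v: "word v" "peq (mmul N (hw (wd x k))) (hw v)" "wd x (length v) = v"
    "it (length v) x = it k x"
    by (rule Gp_merge[OF N(1) x0 x0]) (simp_all add: N(2) sends_self)
  define m where "m = length v"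
  define W where "W = hw (wd x k)"
  have dW: "mdet W = 1" unfolding W_def by (intro posmat_mdet posmat_hw word_wd x0)
  have NW: "peq (mmul N W) (hw (wd x m))" using v m_def W_def by simp
  have canc: "peq N K" if "peq (mmul N W) (mmul K W)" for K
  proof -
    have "peq (mmul (mmul N W) (minv W)) (mmul (mmul K W) (minv W))" by (rule peq_mmul[OF that peq_refl])
    then show ?thesis by (simp add: mmul_assoc dW)
  qed
  show "\<exists>k. peq N (mzpow (hw (wd x n)) k)"
  proof (cases "k \<le> m")
    case True
    obtain q where "hw (wd x m) = mmul (mpow M q) W"
      using key[OF True] v(4) m_def W_def by auto
    then have "peq N (mpow M q)" using NW canc by simp
    then have "peq N (mzpow M (int q))" by (simp add: mzpow_def)
    then show ?thesis unfolding M_def ..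
  next
    case False
    then obtain q where q: "W = mmul (mpow M q) (hw (wd x m))"
      using key[of m k] v(4) m_def W_def by auto
    have "mmul (mpow (minv M) q) W = hw (wd x m)"
      unfolding q minv_mpow[symmetric] using mdet_mpow[OF dM] by simp
    then have "peq N (mpow (minv M) q)" using NW canc by simp
    then have "peq N (mzpow M (- int q))" by (cases "q = 0") (simp_all add: mzpow_def)
    then show ?thesis unfolding M_def ..
  qed
qed

section \<open>Simple forms along orbits\<close>

lemma is_lbqf_form: "M \<in> Gp l \<Longrightarrow> \<bar>mtrace M\<bar> > 2 \<Longrightarrow> is_lbqf l (form M)"
proof -
  assume M: "M \<in> Gp l" "\<bar>mtrace M\<bar> > 2"
  obtain a b c d where abcd: "M = (a,b,c,d)" by (metis surj_pair)
  have Z: "a \<in> Zlam l" "b \<in> Zlam l" "c \<in> Zlam l" "d \<in> Zlam l" using Gp_entries[OF M(1)] abcd by auto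
  have "d + (- a) \<in> Zlam l" "- b \<in> Zlam l" using Z Zlam_add Zlam_minus by blast+
  moreover have "disc (form M) > 0" using disc_form[OF mdet_Gp[OF M(1)]] gt_2_square[OF M(2)] by simp
  ultimately show ?thesis using Z abcd by simp
qed

text \<open>The substitution moves the positive root to its image under \<open>Phi\<close>. Minus
  the conjugate root \<open>t\<close> becomes \<open>(s (j+1) + t*s j) / (s j + t*s (j-1))\<close>,
  again positive. An image 0 would make the last coefficient vanish.\<close>

lemma simple_step:
  assumes "Gp_simple Q" "Phi p l (alphaQ Q) > 0"
  shows "Gp_simple (fcomp Q (H (digit (alphaQ Q))))"
    "alphaQ (fcomp Q (H (digit (alphaQ Q)))) = Phi p l (alphaQ Q)"
proof -
  obtain A B C where Q: "Q = (A,B,C)" by (metis surj_pair)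
  define y where "y = alphaQ Q"
  obtain t where t: "A > 0" "t > 0" "y > 0" "B = A*(t - y)" "C = - A*y*t"
    using simple_factor assms(1) Q y_def by metis
  have y0: "y \<ge> 0" using t by simp
  define j where "j = digit y"
  define z where "z = Phi p l y"
  have z: "z > 0" using assms(2) by (simp add: z_def y_def)
  have j: "1 \<le> j" "j < p" "mob (H j) z = y" using Phi_step[OF y0] by (auto simp: j_def z_def)
  have pj: "posmat (H j)" using posmat_H j by simp
  have sz: "sends (H j) z y" using sends_posmat[OF pj] j z by simp
  obtain k where k: "j = Suc k" using j(1) by (cases j) auto
  have s: "s (Suc k) > 0" "s k \<ge> 0" "s (Suc (Suc k)) \<ge> 0" using j k by (auto intro!: s_pos s_nonneg)
  define m where "m = s k * z + s (Suc k)"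
  have m: "m > 0" unfolding m_def using s z by (intro add_nonneg_pos) auto
  have e: "s (Suc k) * z + s (Suc (Suc k)) = y * m" using sz by (simp add: H_def k m_def)
  have "(s (Suc k) - y * s k) * m = 1" "(s (Suc k) * y - s (Suc (Suc k))) * m = z"
    using e s_det[of k] unfolding m_def by algebra+
  then have 1: "s (Suc k) - y * s k > 0" "s (Suc k) * y - s (Suc (Suc k)) > 0"
    using m z by (metis zero_less_mult_pos2 zero_less_one)+
  have 2: "s (Suc k) + t * s k > 0" using s t by (intro add_pos_nonneg) auto
  have 3: "s (Suc (Suc k)) + t * s (Suc k) > 0" using s t by (intro add_nonneg_pos) auto
  have f: "fcomp Q (H j) = (A * (s (Suc k) - y * s k) * (s (Suc k) + t * s k),
     2*A*s (Suc k)*s (Suc (Suc k)) + B*(s (Suc k)*s (Suc k)+s (Suc (Suc k))*s k) + 2*C*s k*s (Suc k),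
     - (A * (s (Suc k) * y - s (Suc (Suc k))) * (s (Suc (Suc k)) + t * s (Suc k))))"
    unfolding Q H_def k t(4,5) by (simp add: power2_eq_square algebra_simps)
  have 4: "A * (s (Suc k) - y * s k) * (s (Suc k) + t * s k) > 0"
    "A * (s (Suc k) * y - s (Suc (Suc k))) * (s (Suc (Suc k)) + t * s (Suc k)) > 0"
    using 1 2 3 t by simp_all
  show *: "Gp_simple (fcomp Q (H (digit (alphaQ Q))))"
    unfolding y_def[symmetric] j_def[symmetric] f using 4 by simp
  have "sends (H j) (alphaQ (fcomp Q (H j))) y"
    unfolding y_def
    by (rule alphaQ_fcomp[OF posmat_mdet[OF pj] less_imp_le[OF simple_disc[OF assms(1)]]
          simple_fst[OF assms(1)] simple_fst])
      (use * in \<open>simp add: y_def j_def\<close>)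
  then show "alphaQ (fcomp Q (H (digit (alphaQ Q)))) = Phi p l (alphaQ Q)"
    using sends_inj[OF posmat_mdet[OF pj] _ sz] by (simp add: y_def j_def z_def)
qed

text \<open>The step from a simple form to its predecessor is governed by the digit of minus the
  conjugate root, so it is unique.\<close>
lemma simple_back:
  assumes "Gp_simple P" "Gp_simple Q" "Gp_simple (fcomp P (H i))"
    "fcomp P (H i) = fcomp Q (H j)" "1 \<le> i" "i < p" "1 \<le> j" "j < p"
  shows "P = Q"
proof -
  define R where "R = fcomp P (H i)"
  obtain A B C where R: "R = (A,B,C)" by (metis surj_pair)
  define y where "y = alphaQ R"
  obtain t where t: "A > 0" "t > 0" "y > 0" "B = A*(t - y)" "C = - A*y*t"
    using simple_factor assms(3) R R_def y_def by metis
  have key: "dig i t" if i: "1 \<le> i" "i < p" and P: "Gp_simple P" "R = fcomp P (H i)" for i P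
  proof -
    have "fcomp R (minv (H i)) = P" unfolding P(2) fcomp_mmul
      using posmat_mdet[OF posmat_H[OF i]] by simp
    then have "Gp_simple (fcomp R (minv (H i)))" using P(1) by simp
    obtain k where k: "i = Suc k" using i(1) by (cases i) auto
    have s: "s (Suc k) > 0" "s k \<ge> 0" "s (Suc (Suc k)) \<ge> 0" using i k by (auto intro!: s_pos s_nonneg)
    have f: "fcomp R (minv (H i)) = (A * (s (Suc k) + y * s k) * (s (Suc k) - t * s k),
     2*A*s (Suc k)*(- s (Suc (Suc k))) + B*(s (Suc k)*s (Suc k)+s (Suc (Suc k))*s k) + 2*C*(- s k)*s (Suc k),
     A * (s (Suc (Suc k)) + y * s (Suc k)) * (s (Suc (Suc k)) - t * s (Suc k)))"
      unfolding R H_def k t(4,5) by (simp add: power2_eq_square algebra_simps)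
    have "s (Suc k) + y * s k > 0" using s t by (intro add_pos_nonneg) auto
    moreover have "s (Suc (Suc k)) + y * s (Suc k) > 0" using s t by (intro add_nonneg_pos) auto
    ultimately have 1: "A * (s (Suc k) + y * s k) > 0" "A * (s (Suc (Suc k)) + y * s (Suc k)) > 0"
      using t by simp_all
    have "A * (s (Suc k) + y * s k) * (s (Suc k) - t * s k) > 0"
      "A * (s (Suc (Suc k)) + y * s (Suc k)) * (s (Suc (Suc k)) - t * s (Suc k)) < 0"
      using \<open>Gp_simple (fcomp R (minv (H i)))\<close> unfolding f by auto
    then have "s (Suc k) - t * s k > 0" "s (Suc (Suc k)) - t * s (Suc k) < 0"
      using 1 by (simp_all only: zero_less_mult_iff mult_less_0_iff) auto
    then show ?thesis unfolding dig_def k using i k by (simp add: mult.commute)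
  qed
  have "i = j" using dig_unique[OF key key, of i P j Q] assms R_def by simp
  then show ?thesis using assms(4) fcomp_cancel posmat_mdet posmat_H assms(5,6) by metis
qed

text \<open>Positivity of the iterates keeps every form on the way simple, so
  \<open>simple_back\<close> can undo the \<open>k\<close> steps one by one inside the
  cycle.\<close>

lemma simple_trace_back:
  assumes "x > 0" "n \<ge> 1" "it n x = x"
    and "Gp_simple Q" "\<And>i. i \<le> k \<Longrightarrow> it i (alphaQ Q) > 0"
    and "fcomp Q (hw (wd (alphaQ Q) k)) = pform n (it m x)" "k \<le> m"
  shows "Q = pform n (it (m - k) x)"
  using assms(4-)
proof (induction k arbitrary: Q)
  case (Suc k)
  define y where "y = alphaQ Q"
  define R where "R = fcomp Q (H (digit y))"
  have P: "Phi p l y > 0" using Suc.prems(2)[of 1] by (simp add: y_def)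
  have R: "Gp_simple R" "alphaQ R = Phi p l y"
    using simple_step[OF Suc.prems(1)] P by (auto simp: R_def y_def)
  have "R = pform n (it (m - k) x)"
  proof (rule Suc.IH[OF R(1)])
    show "it i (alphaQ R) > 0" if "i \<le> k" for i
      using Suc.prems(2)[of "Suc i"] that by (simp add: R y_def funpow_swap1)
    show "fcomp R (hw (wd (alphaQ R) k)) = pform n (it m x)"
      using Suc.prems(3) unfolding R(2) unfolding R_def y_def[symmetric] wd_Suc_left
      by (simp add: fcomp_mmul)
  qed (use Suc.prems in simp)
  define r where "r = m - Suc k"
  define z where "z = it r x"
  have mk: "m - k = r + 1" using Suc.prems(4) by (simp add: r_def)
  have z: "z > 0" "it n z = z" using it_periodic_pos it_orbit_period assms(1-3) by (auto simp: z_def)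
  have "R = pform n (it 1 z)" using \<open>R = pform n (it (m - k) x)\<close> unfolding mk z_def it_add .
  also have "\<dots> = fcomp (pform n z) (H (digit z))"
    using pform_shift[of z n 1] z by (simp add: wd_Suc)
  finally have e: "fcomp Q (H (digit y)) = fcomp (pform n z) (H (digit z))" by (simp add: R_def)
  have "y > 0" using simple_alphaQ_pos[OF Suc.prems(1)] y_def by simp
  then have "Q = pform n z"
    using simple_back[OF Suc.prems(1) pform_props(1)[OF z(1) assms(2) z(2)] _ e] R(1) R_def
      Phi_step(3,4)[of y] Phi_step(3,4)[of z] z(1) by simp
  then show ?case by (simp add: z_def r_def)
qed simp

text \<open>For the harder inclusion, merging orbits carries a simple \<open>Q\<close> of the class
  forward into the cycle, and \<open>simple_trace_back\<close> then places \<open>Q\<close> itself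
  on it.\<close>

lemma orbit_eq_class:
  assumes "x > 0" "n \<ge> 1" "it n x = x" "\<And>m. 1 \<le> m \<Longrightarrow> m < n \<Longrightarrow> it m x \<noteq> x"
  shows "hyperbolic l (pform n x)" "is_lbqf l (pform n x)"
    "range (\<lambda>k. it k x) =
      {alphaQ Q | Q. Q \<in> {Q'. is_lbqf l Q' \<and> bqf_equiv l (pform n x) Q'} \<and> Gp_simple Q}"
proof -
  have x0: "x \<ge> 0" using assms(1) by simp
  have gp: "hw (wd y k) \<in> Gp l" if "y \<ge> 0" for y k using hw_in_Gp[OF word_wd[OF that]] .
  note pp = pform_props[OF assms(1-3)]
  show hyp: "hyperbolic l (pform n x)"
    unfolding hyperbolic_iff pp(2) using period_generator[OF assms] pp(3) pform_def by blast
  show "is_lbqf l (pform n x)" unfolding pform_def using is_lbqf_form[OF gp[OF x0] pp(3)] .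
  show "range (\<lambda>k. it k x) =
      {alphaQ Q | Q. Q \<in> {Q'. is_lbqf l Q' \<and> bqf_equiv l (pform n x) Q'} \<and> Gp_simple Q}"
  proof (intro equalityI subsetI)
    fix y assume "y \<in> range (\<lambda>k. it k x)"
    then obtain k where y: "y = it k x" by auto
    have y0: "y > 0" "it n y = y" using it_periodic_pos it_orbit_period assms(1-3) by (auto simp: y)
    note yp = pform_props[OF y0(1) assms(2) y0(2)]
    have "bqf_equiv l (pform n x) (pform n y)"
      unfolding bqf_equiv_def y pform_shift[OF x0 assms(3)] using gp[OF x0] by blast
    moreover have "is_lbqf l (pform n y)" unfolding pform_def
      by (rule is_lbqf_form[OF gp yp(3)]) (use y0 in simp)
    ultimately show "y \<in> {alphaQ Q | Q. Q \<in> {Q'. is_lbqf l Q' \<and> bqf_equiv l (pform n x) Q'} \<and> Gp_simple Q}"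
      using yp(1,2) by (intro CollectI exI[of _ "pform n y"]) simp
  next
    fix y assume "y \<in> {alphaQ Q | Q. Q \<in> {Q'. is_lbqf l Q' \<and> bqf_equiv l (pform n x) Q'} \<and> Gp_simple Q}"
    then obtain Q V where Q: "y = alphaQ Q" "Gp_simple Q" "V \<in> Gp l" "Q = fcomp (pform n x) V"
      unfolding bqf_equiv_def by blast
    have y0: "y \<ge> 0" using simple_alphaQ_pos[OF Q(2)] Q(1) by simp
    have "sends V y x" using hyperbolic_fcomp(2)[OF hyp Q(3)] Q pp(2) by simp
    then obtain k v where v: "word v" "peq (mmul V (hw (wd y k))) (hw v)" "wd x (length v) = v"
      "it (length v) x = it k y"
      by (rule Gp_merge[OF Q(3) y0 x0])
    define m where "m = length v"
    have "fcomp Q (hw (wd y k)) = fcomp (pform n x) (hw (wd x m))"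
      unfolding Q(4) fcomp_mmul m_def v(3) by (rule fcomp_peq[OF v(2)])
    also have "\<dots> = pform n (it m x)" by (rule pform_shift[OF x0 assms(3), symmetric])
    \<comment> \<open>Adding \<open>k * n\<close> keeps the orbit point and makes the index large
      enough to go back \<open>k\<close> steps.\<close>
    also have "it m x = it (m + k * n) x"
      unfolding it_add[of m "k * n" x, symmetric, unfolded add.commute[of "k * n"]]
      by (simp add: it_period assms(3))
    finally have e: "fcomp Q (hw (wd (alphaQ Q) k)) = pform n (it (m + k * n) x)" by (simp add: Q(1))
    have pos: "it i (alphaQ Q) > 0" if "i \<le> k" for i
    proof (rule ccontr)
      assume "\<not> it i (alphaQ Q) > 0"
      then have "it i y = 0" using it_nonneg[OF y0, of i] Q(1) by simp
      then have "it (i + (k - i)) y = 0" unfolding it_add[symmetric] by (simp add: it_0)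
      then have "it k y = 0" using that by simp
      then show False using v(4) it_periodic_pos[OF assms(1-3), of "length v"] by simp
    qed
    have "k \<le> m + k * n" using assms(2) by (simp add: trans_le_add2)
    then have "Q = pform n (it (m + k * n - k) x)"
      using simple_trace_back[OF assms(1-3) Q(2) pos e] by blast
    then have "y = it (m + k * n - k) x"
      using Q(1) pform_props(2)[OF it_periodic_pos[OF assms(1-3)] assms(2) it_orbit_period[OF assms(3)]]
      by simp
    then show "y \<in> range (\<lambda>k. it k x)" by blast
  qed
qed

lemma minimal_period:
  assumes "n \<ge> 1" "it n x = x"
  obtains m where "m \<ge> 1" "it m x = x" "\<And>i. 1 \<le> i \<Longrightarrow> i < m \<Longrightarrow> it i x \<noteq> x"
proof -
  define m where "m = (LEAST m. m \<ge> 1 \<and> it m x = x)"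
  have "m \<ge> 1 \<and> it m x = x" unfolding m_def by (rule LeastI[of _ n]) (use assms in auto)
  moreover have "it i x \<noteq> x" if "1 \<le> i" "i < m" for i
    using not_less_Least[of i "\<lambda>m. m \<ge> 1 \<and> it m x = x"] that m_def by auto
  ultimately show ?thesis using that by blast
qed

section \<open>From a hyperbolic class to a periodic point\<close>

lemma translation_in_Gp: "(1, - (real n * l), 0, 1) \<in> Gp l"
proof (induction n)
  case 0
  then show ?case using Gp_id[of l] by (simp add: mid_def)
next
  case (Suc n)
  have "(1, - (real (Suc n) * l), 0, 1) = mmul (minv (Smat l)) (1, - (real n * l), 0, 1)"
    by (simp add: Smat_def algebra_simps)
  then show ?case using Gp_Sinv[OF Suc] by simp
qed

lemma hyperbolic_translate:
  assumes "hyperbolic l Q"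
  obtains V where "V \<in> Gp l" "alphaQ (fcomp Q V) > 0"
proof -
  obtain n where n: "- alphaQ Q < real n * l" using ex_less_of_nat_mult[OF l_pos] by blast
  define V :: mat2 where "V = (1, - (real n * l), 0, 1)"
  have V: "V \<in> Gp l" unfolding V_def by (rule translation_in_Gp)
  have "alphaQ (fcomp Q V) = alphaQ Q + real n * l"
    using hyperbolic_fcomp(2)[OF assms V] unfolding V_def sends_simp by simp
  then show ?thesis using that[OF V] n by simp
qed

text \<open>Otherwise T would move the root to infinity, whereas the transformed form is again
  hyperbolic and has a finite root.\<close>

lemma hyperbolic_alphaQ_nonzero: assumes "hyperbolic l Q" shows "alphaQ Q \<noteq> 0"
proof
  assume 0: "alphaQ Q = 0"
  have "sends Tmat (alphaQ (fcomp Q Tmat)) 0"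
    using hyperbolic_fcomp(2)[OF assms Gp_gens(2)] 0 by simp
  then show False by (simp add: Tmat_def)
qed

lemma hyperbolic_hw_wd:
  assumes "hyperbolic l Q" "alphaQ Q \<ge> 0"
  shows "alphaQ (fcomp Q (hw (wd (alphaQ Q) k))) = it k (alphaQ Q)"
proof -
  have V: "hw (wd (alphaQ Q) k) \<in> Gp l" by (intro hw_in_Gp word_wd assms(2))
  show ?thesis
    by (rule sends_inj[OF mdet_Gp[OF V] hyperbolic_fcomp(2)[OF assms(1) V] sends_hw_wd[OF assms(2)]])
qed

text \<open>Merging the orbit of the root with itself along the generator equates two iterates.
  Their indices differ, since equal ones would cancel to a trivial generator.\<close>

lemma hyperbolic_eventually_periodic:
  assumes "hyperbolic l Q" "alphaQ Q > 0"
  obtains k n where "n \<ge> 1" "it n (it k (alphaQ Q)) = it k (alphaQ Q)"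
proof -
  define y where "y = alphaQ Q"
  have y0: "y \<ge> 0" using assms(2) by (simp add: y_def)
  obtain M where M: "stab_generator l M y" "\<bar>mtrace M\<bar> > 2" "Q = form M"
    using assms(1) hyperbolic_iff y_def by blast
  have "sends M y y" using stab_generatorD(3)[OF M(1)] sends_self by blast
  then obtain k v where v: "word v" "peq (mmul M (hw (wd y k))) (hw v)" "wd y (length v) = v"
      "it (length v) y = it k y"
    by (rule Gp_merge[OF stab_generatorD(1)[OF M(1)] y0 y0])
  define m where "m = length v"
  have "m \<noteq> k"
  proof
    assume "m = k"
    then have "peq (mmul M (hw v)) (hw v)" using v m_def by simp
    then have "peq (mmul (mmul M (hw v)) (minv (hw v))) (mmul (hw v) (minv (hw v)))"
      by (rule peq_mmul) simp
    then have "peq M mid" using posmat_mdet[OF posmat_hw[OF v(1)]] by (simp add: mmul_assoc)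
    then have "\<bar>mtrace M\<bar> = 2" by (auto simp: peq_def mid_def)
    then show False using M(2) by simp
  qed
  moreover have "\<exists>n\<ge>1. it n (it i y) = it i y" if "i < j" "it i y = it j y" for i j
  proof -
    have "it (j - i) (it i y) = it j y" using that(1) by (simp add: it_add)
    then show ?thesis using that by (intro exI[of _ "j - i"]) simp
  qed
  ultimately have "\<exists>i n. n \<ge> 1 \<and> it n (it i y) = it i y"
    using v(4) m_def by (metis nat_neq_iff)
  then show ?thesis using that y_def by blast
qed

lemma bqf_equiv_class_eq:
  assumes "V \<in> Gp l" shows "bqf_equiv l Q R \<longleftrightarrow> bqf_equiv l (fcomp Q V) R"
proof
  assume "bqf_equiv l Q R"
  then obtain W where W: "W \<in> Gp l" "R = fcomp Q W" unfolding bqf_equiv_def by blast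
  have "R = fcomp (fcomp Q V) (mmul (minv V) W)"
    using W mdet_Gp[OF assms] by (simp add: fcomp_mmul)
  moreover have "mmul (minv V) W \<in> Gp l" using W assms by (intro Gp_mmul Gp_minv)
  ultimately show "bqf_equiv l (fcomp Q V) R" unfolding bqf_equiv_def by blast
next
  assume "bqf_equiv l (fcomp Q V) R"
  then show "bqf_equiv l Q R" unfolding bqf_equiv_def fcomp_mmul using assms Gp_mmul by blast
qed

text \<open>A translation makes the root positive and its orbit is followed into the cycle. There
  \<open>hyperbolic_eqI\<close> identifies the transported form with the form of the minimal
  period.\<close>

lemma hyperbolic_class_periodic:
  assumes "hyperbolic l Q"
  obtains x n where "x > 0" "n \<ge> 1" "it n x = x"
    "range (\<lambda>k. it k x) = {alphaQ R | R. R \<in> {R. is_lbqf l R \<and> bqf_equiv l Q R} \<and> Gp_simple R}"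
proof -
  obtain V where V: "V \<in> Gp l" "alphaQ (fcomp Q V) > 0" using hyperbolic_translate[OF assms] .
  define Q1 where "Q1 = fcomp Q V"
  have Q1: "hyperbolic l Q1" "alphaQ Q1 > 0" "alphaQ Q1 \<ge> 0"
    using hyperbolic_fcomp(1)[OF assms V(1)] V(2) Q1_def by auto
  obtain k n0 where n0: "n0 \<ge> 1" "it n0 (it k (alphaQ Q1)) = it k (alphaQ Q1)"
    using hyperbolic_eventually_periodic[OF Q1(1,2)] .
  define x where "x = it k (alphaQ Q1)"
  obtain n where n: "n \<ge> 1" "it n x = x" "\<And>i. 1 \<le> i \<Longrightarrow> i < n \<Longrightarrow> it i x \<noteq> x"
    using minimal_period[OF n0] x_def by blast
  define W where "W = hw (wd (alphaQ Q1) k)"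
  have W: "W \<in> Gp l" unfolding W_def by (intro hw_in_Gp word_wd Q1(3))
  have Q2: "hyperbolic l (fcomp Q1 W)" "alphaQ (fcomp Q1 W) = x"
    using hyperbolic_fcomp(1)[OF Q1(1) W] hyperbolic_hw_wd[OF Q1(1,3)] W_def x_def by auto
  have x: "x > 0"
    using hyperbolic_alphaQ_nonzero[OF Q2(1)] Q2(2) it_nonneg[OF Q1(3), of k] x_def by simp
  note oc = orbit_eq_class[OF x n]
  have "fcomp Q1 W = pform n x"
    using hyperbolic_eqI[OF Q2(1) oc(1)] Q2(2) pform_props(2)[OF x n(1,2)] by simp
  then have "bqf_equiv l Q R \<longleftrightarrow> bqf_equiv l (pform n x) R" for R
    using bqf_equiv_class_eq[OF V(1)] bqf_equiv_class_eq[OF W] Q1_def by metis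
  then show ?thesis using that[OF x n(1,2)] oc(3) by simp
qed

lemma finite_orbit_iff:
  "finite_orbit p l Orb \<longleftrightarrow>
    (Orb = {0} \<or> (\<exists>\<A>. bqf_class l \<A> \<and> (\<forall>Q \<in> \<A>. hyperbolic l Q) \<and>
      Orb = {alphaQ Q | Q. Q \<in> \<A> \<and> Gp_simple Q}))"
proof
  assume "finite_orbit p l Orb"
  then obtain x n where xn: "0 \<le> x" "n \<ge> 1" "it n x = x" "Orb = {it k x | k. k < n}"
    unfolding finite_orbit_def by blast
  have O: "Orb = range (\<lambda>k. it k x)" using xn(4) orbit_set[OF xn(2,3)] by simp
  show "Orb = {0} \<or> (\<exists>\<A>. bqf_class l \<A> \<and> (\<forall>Q \<in> \<A>. hyperbolic l Q) \<and>
      Orb = {alphaQ Q | Q. Q \<in> \<A> \<and> Gp_simple Q})"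
  proof (cases "x = 0")
    case True
    then show ?thesis using O by (auto simp: it_0)
  next
    case False
    then have x: "x > 0" using xn(1) by simp
    \<comment> \<open>\<open>n\<close> may be any period; the least one is taken so that its word
      generates the stabilizer.\<close>
    obtain m where m: "m \<ge> 1" "it m x = x" "\<And>i. 1 \<le> i \<Longrightarrow> i < m \<Longrightarrow> it i x \<noteq> x"
      using minimal_period[OF xn(2,3)] by blast
    note oc = orbit_eq_class[OF x m]
    define \<A> where "\<A> = {Q'. is_lbqf l Q' \<and> bqf_equiv l (pform m x) Q'}"
    have "bqf_class l \<A>" unfolding bqf_class_def \<A>_def using oc(2) by blast
    moreover have "\<forall>Q \<in> \<A>. hyperbolic l Q"
      unfolding \<A>_def bqf_equiv_def using hyperbolic_fcomp(1)[OF oc(1)] by blast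
    moreover have "Orb = {alphaQ Q | Q. Q \<in> \<A> \<and> Gp_simple Q}" using O oc(3) \<A>_def by simp
    ultimately show ?thesis by blast
  qed
next
  assume "Orb = {0} \<or> (\<exists>\<A>. bqf_class l \<A> \<and> (\<forall>Q \<in> \<A>. hyperbolic l Q) \<and>
      Orb = {alphaQ Q | Q. Q \<in> \<A> \<and> Gp_simple Q})"
  then show "finite_orbit p l Orb"
  proof
    assume "Orb = {0}"
    then show ?thesis unfolding finite_orbit_def
      by (intro exI[of _ "0::real"] exI[of _ "1::nat"]) (auto simp: Phi_0)
  next
    assume "\<exists>\<A>. bqf_class l \<A> \<and> (\<forall>Q \<in> \<A>. hyperbolic l Q) \<and>
      Orb = {alphaQ Q | Q. Q \<in> \<A> \<and> Gp_simple Q}"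
    then obtain Q where Q: "is_lbqf l Q" "\<forall>R\<in>{R. is_lbqf l R \<and> bqf_equiv l Q R}. hyperbolic l R"
      "Orb = {alphaQ R | R. R \<in> {R. is_lbqf l R \<and> bqf_equiv l Q R} \<and> Gp_simple R}"
      unfolding bqf_class_def by blast
    have "bqf_equiv l Q Q" unfolding bqf_equiv_def using Gp_id by (intro bexI[of _ mid]) auto
    then have "hyperbolic l Q" using Q by blast
    then obtain x n where xn: "x > 0" "n \<ge> 1" "it n x = x" "range (\<lambda>k. it k x) = Orb"
      unfolding Q(3) by (rule hyperbolic_class_periodic)
    then show ?thesis unfolding finite_orbit_def
      using orbit_set[OF xn(2,3)] by (intro exI[of _ x] exI[of _ n]) auto
  qed
qed

end

theorem theorem6p4:
  fixes p :: nat and l :: real and Orb :: "real set"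
  assumes "p \<ge> 3" and "l = 2 * cos (pi / real p)"
  shows "finite_orbit p l Orb \<longleftrightarrow>
           (Orb = {0} \<or>
            (\<exists>\<A>. bqf_class l \<A> \<and> (\<forall>Q \<in> \<A>. hyperbolic l Q) \<and>
                  Orb = {alphaQ Q | Q. Q \<in> \<A> \<and> Gp_simple Q}))"
proof -
  interpret hecke p l using assms by unfold_locales
  show ?thesis by (rule finite_orbit_iff)
qed

end
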